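(* Let $\alpha$ be a fixed partition with $\alpha/\tilde\alpha\vdash 2k$, where $\tilde\alpha$ is the 2-core of $\alpha$, and let $n\ge0$. Then $$W_n^\alpha=\sum_{j=0}^k\binom{n}{j}W_{-j}^\alpha\sum_{\pi\in CI_{n-j}}{\rm wt}(\pi).$$
   Context: Partitions are identified with Young diagrams (cell $(i,j)$: row $i$, column $j$); for $\mu\subseteq\lambda$, $\lambda/\mu$ is the set of cells of $\lambda$ not in $\mu$, $\lambda/\mu\vdash n$ means it has $n$ cells; $v(\lambda/\mu)$, $h(\lambda/\mu)$ are its numbers of cells in even rows, resp. even columns. The 2-core $\tilde\alpha$ is obtained by repeatedly removing a domino (two adjacent cells) leaving a partition until impossible. An SDT of shape $\lambda/\mu\vdash 2n$ is a bijection from the cells to $[2n]$ increasing along rows and columns such that entries $2i-1,2i$ form a domino for each $i$; for an SDT $D$, $sp(D)$ is half its number of vertical dominoes; $f_2^{\lambda/\mu}(q)=\sum_D q^{sp(D)}$ over SDTs of shape $\lambda/\mu$. For $n\ge0$, $W_n^\alpha=\sum_{\lambda:\ \lambda/\alpha\vdash 2n}x^{n-v(\lambda/\alpha)}y^{n-h(\lambda/\alpha)}f_2^{\lambda/\alpha}(q)$ and $W_{-n}^\alpha=\sum_{\mu:\ \alpha/\mu\vdash2n}x^{-n+v(\alpha/\mu)}y^{-n+h(\alpha/\mu)}f_2^{\alpha/\mu}(q)$. A colored permutation of $[n]$ is a permutation with bars on some values; its permutation matrix has $(i,k)$ entry $1$ if $\pi_i=k$, $-1$ if $\pi_i=\bar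 k$, $0$ otherwise; $tc(\pi)$ is the number of barred values. $CI_n$ is the set of colored permutations of $[n]$ with symmetric permutation matrix (colored involutions), $CI_0=\{\emptyset\}$. Such $\pi$ consists of 1-cycles and 2-cycles; $\sigma_1(\pi)$, $\bar\sigma_1(\pi)$ are its numbers of unbarred, resp. barred, 1-cycles, and ${\rm wt}(\pi)=x^{\sigma_1(\pi)}y^{\bar\sigma_1(\pi)}q^{tc(\pi)/2}$ (the empty involution has weight $1$). *)

theory Defs
  imports
    Complex_Main
    "HOL-Library.FuncSet"
    "HOL-Library.Poly_Mapping"
    "HOL-Library.Product_Plus"
    "HOL-Combinatorics.Permutations"
begin

type_synonym cell = "nat \<times> nat"

definition is_partition :: "nat list \<Rightarrow> bool" where
  "is_partition l \<longleftrightarrow> sorted_wrt (\<ge>) l \<and> 0 \<notin> set l"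

text \<open>Cells are pairs (row, column), both numbered from 1; the parity of the indices matters.\<close>

definition cells :: "nat list \<Rightarrow> cell set" where
  "cells l = {(i, j). 1 \<le> i \<and> i \<le> length l \<and> 1 \<le> j \<and> j \<le> l ! (i - 1)}"

definition skew :: "nat list \<Rightarrow> nat list \<Rightarrow> cell set" where
  "skew l m = cells l - cells m"

definition skew_size :: "nat list \<Rightarrow> nat list \<Rightarrow> nat \<Rightarrow> bool" where
  "skew_size l m n \<longleftrightarrow> cells m \<subseteq> cells l \<and> card (skew l m) = n"

definition even_row_cells :: "cell set \<Rightarrow> nat" where
  "even_row_cells S = card {(i, j) \<in> S. even i}"

definition even_col_cells :: "cell set \<Rightarrow> nat" where
  "even_col_cells S = card {(i, j) \<in> S. even j}"

definition horizontal_domino :: "cell set \<Rightarrow> bool" where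
  "horizontal_domino S \<longleftrightarrow> (\<exists>i j. S = {(i, j), (i, j + 1)})"

definition vertical_domino :: "cell set \<Rightarrow> bool" where
  "vertical_domino S \<longleftrightarrow> (\<exists>i j. S = {(i, j), (i + 1, j)})"

definition is_domino :: "cell set \<Rightarrow> bool" where
  "is_domino S \<longleftrightarrow> horizontal_domino S \<or> vertical_domino S"

definition remove_domino :: "nat list \<Rightarrow> nat list \<Rightarrow> bool" where
  "remove_domino l m \<longleftrightarrow>
     is_partition l \<and> is_partition m \<and> cells m \<subseteq> cells l \<and> is_domino (skew l m)"

text \<open>\<open>is_two_core c a\<close>: \<open>c\<close> is the outcome of some maximal sequence of domino removals from \<open>a\<close>.
  All such sequences have the same outcome, the 2-core of \<open>a\<close>.\<close>

definition is_two_core :: "nat list \<Rightarrow> nat list \<Rightarrow> bool" where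
  "is_two_core c a \<longleftrightarrow> remove_domino\<^sup>*\<^sup>* a c \<and> (\<nexists>m. remove_domino c m)"

definition domino_of :: "cell set \<Rightarrow> (cell \<Rightarrow> nat) \<Rightarrow> nat \<Rightarrow> cell set" where
  "domino_of S D i = {c \<in> S. D c \<in> {2 * i - 1, 2 * i}}"

text \<open>Tableaux are made extensional, so that distinct functions are distinct fillings of \<open>S\<close>.\<close>

definition is_SDT :: "nat \<Rightarrow> cell set \<Rightarrow> (cell \<Rightarrow> nat) \<Rightarrow> bool" where
  "is_SDT n S D \<longleftrightarrow>
     D \<in> extensional S \<and> bij_betw D S {1..2 * n} \<and>
     (\<forall>i j j'. (i, j) \<in> S \<and> (i, j') \<in> S \<and> j < j' \<longrightarrow> D (i, j) < D (i, j')) \<and>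
     (\<forall>i i' j. (i, j) \<in> S \<and> (i', j) \<in> S \<and> i < i' \<longrightarrow> D (i, j) < D (i', j)) \<and>
     (\<forall>i \<in> {1..n}. is_domino (domino_of S D i))"

definition sp :: "nat \<Rightarrow> cell set \<Rightarrow> (cell \<Rightarrow> nat) \<Rightarrow> rat" where
  "sp n S D = of_nat (card {i \<in> {1..n}. vertical_domino (domino_of S D i)}) / 2"

text \<open>The monoid ring over the integers with exponents in \<open>int \<times> int \<times> rat\<close>: it contains the ring
  of Laurent polynomials in \<open>x\<close>, \<open>y\<close> and the square root of \<open>q\<close>, and \<open>mon a b c\<close> is the
  monomial \<open>x\<^sup>a y\<^sup>b q\<^sup>c\<close>. Negative exponents of \<open>x\<close> and \<open>y\<close> do occur below.\<close>

type_synonym laurent = "(int \<times> int \<times> rat) \<Rightarrow>\<^sub>0 int"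

definition mon :: "int \<Rightarrow> int \<Rightarrow> rat \<Rightarrow> laurent" where
  "mon a b c = Poly_Mapping.single (a, b, c) 1"

definition f2 :: "nat \<Rightarrow> cell set \<Rightarrow> laurent" where
  "f2 n S = (\<Sum>D | is_SDT n S D. mon 0 0 (sp n S D))"

text \<open>\<open>W_pos a n\<close> and \<open>W_neg a n\<close> are \<open>W\<close> with upper index \<open>a\<close> and lower index \<open>n\<close> and \<open>-n\<close>.\<close>

definition W_pos :: "nat list \<Rightarrow> nat \<Rightarrow> laurent" where
  "W_pos a n = (\<Sum>l | is_partition l \<and> skew_size l a (2 * n).
     mon (int n - int (even_row_cells (skew l a))) (int n - int (even_col_cells (skew l a))) 0 *
     f2 n (skew l a))"

definition W_neg :: "nat list \<Rightarrow> nat \<Rightarrow> laurent" where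
  "W_neg a n = (\<Sum>m | is_partition m \<and> skew_size a m (2 * n).
     mon (- int n + int (even_row_cells (skew a m))) (- int n + int (even_col_cells (skew a m))) 0 *
     f2 n (skew a m))"

text \<open>A colored permutation is a pair \<open>(p, B)\<close> of the underlying permutation and the set of
  barred values.\<close>

type_synonym colored_perm = "(nat \<Rightarrow> nat) \<times> nat set"

definition colored_perms :: "nat \<Rightarrow> colored_perm set" where
  "colored_perms n = {(p, B). p permutes {1..n} \<and> B \<subseteq> {1..n}}"

fun perm_matrix :: "colored_perm \<Rightarrow> nat \<Rightarrow> nat \<Rightarrow> int" where
  "perm_matrix (p, B) i k = (if p i = k then (if k \<in> B then -1 else 1) else 0)"

definition CI :: "nat \<Rightarrow> colored_perm set" where
  "CI n = {\<pi> \<in> colored_perms n.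
     \<forall>i \<in> {1..n}. \<forall>k \<in> {1..n}. perm_matrix \<pi> i k = perm_matrix \<pi> k i}"

fun tc :: "colored_perm \<Rightarrow> nat" where
  "tc (p, B) = card B"

fun unbarred_fixed :: "nat \<Rightarrow> colored_perm \<Rightarrow> nat" where
  "unbarred_fixed n (p, B) = card {i \<in> {1..n}. p i = i \<and> i \<notin> B}"

fun barred_fixed :: "nat \<Rightarrow> colored_perm \<Rightarrow> nat" where
  "barred_fixed n (p, B) = card {i \<in> {1..n}. p i = i \<and> i \<in> B}"

definition wt :: "nat \<Rightarrow> colored_perm \<Rightarrow> laurent" where
  "wt n \<pi> = mon (int (unbarred_fixed n \<pi>)) (int (barred_fixed n \<pi>)) (of_nat (tc \<pi>) / 2)"

text \<open>The index sets of the sums above are finite, so no sum degenerates to 0, and every partition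
  has a 2-core.\<close>

lemma finite_cells: "finite (cells l)"
proof (rule finite_subset)
  show "cells l \<subseteq> {1..length l} \<times> {..sum_list l}"
    by (auto simp: cells_def intro!: order.trans[OF _ member_le_sum_list])
qed simp

lemma card_cells: "card (cells l) = sum_list l"
proof -
  have "cells l = (SIGMA i:{1..length l}. {1..l ! (i - 1)})"
    by (auto simp: cells_def)
  then have "card (cells l) = (\<Sum>i = 1..length l. l ! (i - 1))"
    by simp
  also have "\<dots> = (\<Sum>i < length l. l ! i)"
    by (rule sum.reindex_bij_witness[of _ Suc "\<lambda>i. i - 1"]) auto
  finally show ?thesis
    by (simp add: sum_list_sum_nth atLeast0LessThan)
qed

lemma length_le_sum_list: "0 \<notin> set l \<Longrightarrow> length l \<le> sum_list (l :: nat list)"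
  by (induction l) auto

lemma finite_partitions_le: "finite {l. is_partition l \<and> card (cells l) \<le> N}"
proof (rule finite_subset)
  show "{l. is_partition l \<and> card (cells l) \<le> N} \<subseteq> {l. set l \<subseteq> {..N} \<and> length l \<le> N}"
    using length_le_sum_list member_le_sum_list
    by (fastforce simp: card_cells is_partition_def intro: order.trans)
qed (simp add: finite_lists_length_le)

lemma finite_partitions_above: "finite {l. is_partition l \<and> skew_size l a n}"
proof (rule finite_subset)
  show "{l. is_partition l \<and> skew_size l a n} \<subseteq> {l. is_partition l \<and> card (cells l) \<le> card (cells a) + n}"
    by (auto simp: skew_size_def skew_def card_Diff_subset finite_cells)
qed (rule finite_partitions_le)

lemma finite_partitions_below: "finite {m. is_partition m \<and> skew_size a m n}"
proof (rule finite_subset)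
  show "{m. is_partition m \<and> skew_size a m n} \<subseteq> {m. is_partition m \<and> card (cells m) \<le> card (cells a)}"
    by (auto simp: skew_size_def intro: card_mono finite_cells)
qed (rule finite_partitions_le)

lemma finite_SDT: "finite S \<Longrightarrow> finite {D. is_SDT n S D}"
proof (rule finite_subset)
  show "{D. is_SDT n S D} \<subseteq> S \<rightarrow>\<^sub>E {1..2 * n}"
    by (auto simp: is_SDT_def PiE_def dest: bij_betw_imp_funcset)
qed (simp add: finite_PiE)

lemma finite_CI: "finite (CI n)"
proof (rule finite_subset)
  show "CI n \<subseteq> {p. p permutes {1..n}} \<times> Pow {1..n}"
    by (auto simp: CI_def colored_perms_def)
qed (simp add: finite_permutations)

lemma remove_domino_card: "remove_domino l m \<Longrightarrow> card (cells m) < card (cells l)"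
  by (rule psubset_card_mono[OF finite_cells])
    (auto simp: remove_domino_def is_domino_def horizontal_domino_def vertical_domino_def skew_def)

lemma two_core_exists: "\<exists>c. is_two_core c a"
proof (induction "card (cells a)" arbitrary: a rule: less_induct)
  case less
  show ?case
  proof (cases "\<exists>m. remove_domino a m")
    case True
    then obtain m where m: "remove_domino a m" ..
    with less[OF remove_domino_card] obtain c where "is_two_core c m" by blast
    with m show ?thesis
      by (auto simp: is_two_core_def intro: converse_rtranclp_into_rtranclp)
  next
    case False
    then show ?thesis by (auto simp: is_two_core_def)
  qed
qed

end

theory Submission
  imports Defs
begin

text \<open>
  Let \<open>U\<close> and \<open>D\<close> be the operators on functions of partitions that sum over all ways of adding,
  respectively removing, one domino, weighted by its contribution to \<open>W\<close>. Since a standard domino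
  tableau is a chain of domino additions, \<open>W\<^sub>n = U\<^sup>n 1\<close> and \<open>W\<^sub>-\<^sub>n = D\<^sup>n 1\<close>.
  A horizontal domino can be removed from row \<open>i\<close> iff one can be added to row \<open>i + 1\<close>, with equal
  weights, and the same holds for vertical dominoes and columns; only the additions to the first row
  and the first column are unpaired.
  Together with a diamond property this gives \<open>U 1 = D 1 + (x + y q\<^sup>1\<^sup>/\<^sup>2)\<close> and \<open>U D - D U = 1 + q\<close>.
  The generating functions \<open>I\<^sub>n\<close> of colored involutions satisfy
  \<open>I\<^sub>n\<^sub>+\<^sub>1 = (x + y q\<^sup>1\<^sup>/\<^sup>2) I\<^sub>n + n (1 + q) I\<^sub>n\<^sub>-\<^sub>1\<close>, so
  \<open>U\<^sup>n 1 = \<Sum>\<^sub>j (n choose j) I\<^sub>n\<^sub>-\<^sub>j D\<^sup>j 1\<close> follows by induction on \<open>n\<close>. By the diamond property all maximal sequences of domino removals from \<open>\<alpha>\<close> have length \<open>k\<close>,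
  so \<open>D\<^sup>j 1\<close> vanishes at \<open>\<alpha>\<close> for \<open>j > k\<close>.
\<close>

subsection \<open>Young diagrams as sets of cells\<close>

text \<open>Working with finite down-closed sets of cells makes adding and removing dominoes, unions
  and intersections plain set operations; \<open>bij_betw_cells\<close> translates back to
  partitions.\<close>

definition young :: "cell set \<Rightarrow> bool" where
  "young S \<longleftrightarrow> finite S \<and> S \<subseteq> {1..} \<times> {1..} \<and>
     (\<forall>i j i' j'. (i, j) \<in> S \<and> 1 \<le> i' \<and> i' \<le> i \<and> 1 \<le> j' \<and> j' \<le> j \<longrightarrow> (i', j') \<in> S)"

lemma young_finite: "young S \<Longrightarrow> finite S"
  and young_pos: "young S \<Longrightarrow> (i, j) \<in> S \<Longrightarrow> 1 \<le> i \<and> 1 \<le> j"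
  and young_down: "young S \<Longrightarrow> (i, j) \<in> S \<Longrightarrow> 1 \<le> i' \<Longrightarrow> i' \<le> i \<Longrightarrow> 1 \<le> j' \<Longrightarrow> j' \<le> j \<Longrightarrow> (i', j') \<in> S"
  unfolding young_def by auto

lemma young_up:
  "young S \<Longrightarrow> (i, j) \<notin> S \<Longrightarrow> 1 \<le> i \<Longrightarrow> 1 \<le> j \<Longrightarrow> i \<le> i' \<Longrightarrow> j \<le> j' \<Longrightarrow> (i', j') \<notin> S"
  using young_down by blast

lemma youngI:
  assumes "finite S"
    and "\<And>i j. (i, j) \<in> S \<Longrightarrow> 1 \<le> i \<and> 1 \<le> j"
    and "\<And>i j i' j'. (i, j) \<in> S \<Longrightarrow> 1 \<le> i' \<Longrightarrow> i' \<le> i \<Longrightarrow> 1 \<le> j' \<Longrightarrow> j' \<le> j \<Longrightarrow> (i', j') \<in> S"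
  shows "young S"
  unfolding young_def
proof (intro conjI allI impI subsetI)
  show "x \<in> {1..} \<times> {1..}" if "x \<in> S" for x
    using assms(2)[of "fst x" "snd x"] that by (auto simp: mem_Times_iff)
qed (use assms(1,3) in blast)+

lemma young_Int: "young S \<Longrightarrow> young T \<Longrightarrow> young (S \<inter> T)"
  by (rule youngI) (auto simp: young_finite dest: young_pos intro: young_down)

lemma young_Un: "young S \<Longrightarrow> young T \<Longrightarrow> young (S \<union> T)"
  by (rule youngI) (auto simp: young_finite dest: young_pos intro: young_down)

text \<open>Used for the rows and for the first column of a diagram.\<close>

lemma initial_segment:
  fixes A :: "nat set"
  assumes "finite A" "0 \<notin> A" "\<And>a b. a \<in> A \<Longrightarrow> 1 \<le> b \<Longrightarrow> b \<le> a \<Longrightarrow> b \<in> A"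
  shows "A = {1..card A}"
proof (cases "A = {}")
  case False
  have "A = {1..Max A}"
  proof (intro equalityI subsetI)
    fix x assume "x \<in> A"
    then show "x \<in> {1..Max A}" using assms(1,2) by (cases x) auto
  next
    fix x assume "x \<in> {1..Max A}"
    then show "x \<in> A" using assms(3)[of "Max A" x] Max_in[OF assms(1) False] by auto
  qed
  then have "card A = Max A" by (metis card_atLeastAtMost diff_Suc_1)
  with \<open>A = {1..Max A}\<close> show ?thesis by simp
qed simp

definition row_len :: "cell set \<Rightarrow> nat \<Rightarrow> nat" where
  "row_len S i = card {j. (i, j) \<in> S}"

lemma young_row:
  assumes "young S"
  shows "{j. (i, j) \<in> S} = {1..row_len S i}"
  unfolding row_len_def
proof (rule initial_segment)
  have "{j. (i, j) \<in> S} \<subseteq> snd ` S" by force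
  then show "finite {j. (i, j) \<in> S}" using young_finite[OF assms] finite_subset by blast
  show "0 \<notin> {j. (i, j) \<in> S}" using young_pos[OF assms, of i 0] by auto
  show "b \<in> {j. (i, j) \<in> S}" if "a \<in> {j. (i, j) \<in> S}" "1 \<le> b" "b \<le> a" for a b
    using that young_down[OF assms, of i a i b] young_pos[OF assms, of i a] by auto
qed

lemma young_mem:
  assumes "young S"
  shows "(i, j) \<in> S \<longleftrightarrow> 1 \<le> j \<and> j \<le> row_len S i"
  using young_row[OF assms, of i] by (auto simp: set_eq_iff)

lemma row_len_antimono:
  assumes "young S" "1 \<le> i" "i \<le> i'"
  shows "row_len S i' \<le> row_len S i"
proof (cases "row_len S i' = 0")
  case False
  then have "(i', row_len S i') \<in> S" using young_mem[OF assms(1)] by simp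
  then have "(i, row_len S i') \<in> S" using young_down[OF assms(1)] assms False by simp
  then show ?thesis using young_mem[OF assms(1)] by simp
qed simp

lemma young_cells:
  assumes "is_partition l"
  shows "young (cells l)"
proof -
  have *: "l ! i' \<le> l ! i" if "i \<le> i'" "i' < length l" for i i'
    using assms that unfolding is_partition_def sorted_wrt_iff_nth_less
    by (cases "i = i'") auto
  have "j' \<le> l ! (i' - 1)" if "i' \<le> i" "i \<le> length l" "1 \<le> i" "j \<le> l ! (i - 1)" "j' \<le> j"
      for i i' j j'
  proof -
    have "l ! (i - 1) \<le> l ! (i' - 1)" using that by (intro *) auto
    then show ?thesis using that by simp
  qed
  then show ?thesis
    unfolding young_def using finite_cells[of l] by (auto simp: cells_def)
qed

lemma row_len_cells: "i < length l \<Longrightarrow> row_len (cells l) (Suc i) = l ! i"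
proof -
  assume "i < length l"
  then have "{j. (Suc i, j) \<in> cells l} = {1..l ! i}" by (auto simp: cells_def)
  then show ?thesis by (simp add: row_len_def)
qed

text \<open>Since no part is 0, the first column shows the number of parts; the row lengths then
  show the parts themselves.\<close>

lemma inj_on_cells: "inj_on cells {l. is_partition l}"
proof (rule inj_onI)
  fix l m assume lm: "l \<in> {l. is_partition l}" "m \<in> {l. is_partition l}" and eq: "cells l = cells m"
  have "{i. (i, 1) \<in> cells l} = {1..length l}" if "is_partition l" for l
  proof -
    have "1 \<le> l ! (i - 1)" if "1 \<le> i" "i \<le> length l" for i
    proof -
      have "l ! (i - 1) \<in> set l" using that by simp
      then have "l ! (i - 1) \<noteq> 0"
        using \<open>is_partition l\<close> unfolding is_partition_def by metis
      then show ?thesis by simp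
    qed
    then show ?thesis unfolding cells_def by auto
  qed
  then have "{1..length l} = {1..length m}" using lm eq by blast
  then have len: "length l = length m" by (metis card_atLeastAtMost diff_Suc_1)
  show "l = m"
  proof (rule nth_equalityI[OF len])
    show "l ! i = m ! i" if "i < length l" for i
      using row_len_cells[of i l] row_len_cells[of i m] that len eq by simp
  qed
qed

lemma young_is_cells:
  assumes "young S"
  obtains l where "is_partition l" "cells l = S"
proof
  define k where "k = card {i. (i, 1) \<in> S}"
  have "finite {i. (i, 1) \<in> S}"
    using young_finite[OF assms] by (rule finite_subset[rotated, OF finite_imageI[of S fst]]) force
  then have k: "{i. (i, 1) \<in> S} = {1..k}"
    unfolding k_def
  proof (rule initial_segment)
    show "0 \<notin> {i. (i, 1) \<in> S}" using young_pos[OF assms, of 0 1] by auto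
    show "b \<in> {i. (i, 1) \<in> S}" if "a \<in> {i. (i, 1) \<in> S}" "1 \<le> b" "b \<le> a" for a b
      using that young_down[OF assms, of a 1 b 1] by auto
  qed
  let ?l = "map (\<lambda>i. row_len S (Suc i)) [0..<k]"
  have pos: "1 \<le> row_len S (Suc i)" if "i < k" for i
    using k that young_mem[OF assms, of "Suc i" 1] by auto
  have "0 \<notin> set ?l" using pos by fastforce
  then show "is_partition ?l"
    using row_len_antimono[OF assms] unfolding is_partition_def sorted_wrt_iff_nth_less
    by auto
  show "cells ?l = S"
  proof (intro set_eqI, clarify)
    fix i j
    have "1 \<le> i \<and> i \<le> k" if "(i, j) \<in> S"
      using k young_down[OF assms that, of i 1] young_pos[OF assms that] by auto
    then show "(i, j) \<in> cells ?l \<longleftrightarrow> (i, j) \<in> S"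
      unfolding cells_def by (auto simp: young_mem[OF assms])
  qed
qed

text \<open>The predicate \<open>P\<close> is kept general because the sums in both
  \<open>W_pos\<close> and \<open>W_neg\<close> are transported along this bijection, one over
  diagrams above and one over diagrams below a fixed one.\<close>

lemma bij_betw_cells: "bij_betw cells {l. is_partition l \<and> P (cells l)} {S. young S \<and> P S}"
  unfolding bij_betw_def
proof
  show "inj_on cells {l. is_partition l \<and> P (cells l)}"
    by (rule inj_on_subset[OF inj_on_cells]) auto
  show "cells ` {l. is_partition l \<and> P (cells l)} = {S. young S \<and> P S}"
    using young_cells by (auto elim!: young_is_cells)
qed

lemma finite_young_above: "young S \<Longrightarrow> finite {A. young A \<and> S \<subseteq> A \<and> card (A - S) = n}"
proof -
  assume "young S"
  then obtain a where a: "cells a = S" by (rule young_is_cells)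
  have "bij_betw cells {l. is_partition l \<and> skew_size l a n} {A. young A \<and> S \<subseteq> A \<and> card (A - S) =
      n}"
    using bij_betw_cells[of "\<lambda>A. S \<subseteq> A \<and> card (A - S) = n"] by (simp add: skew_size_def skew_def a)
  then show ?thesis using finite_partitions_above bij_betw_finite by blast
qed

subsection \<open>Adding and removing dominoes\<close>

definition ups :: "cell set \<Rightarrow> cell set set" where
  "ups S = {A. young A \<and> S \<subseteq> A \<and> is_domino (A - S)}"

definition downs :: "cell set \<Rightarrow> cell set set" where
  "downs S = {B. young B \<and> B \<subseteq> S \<and> is_domino (S - B)}"

lemma card_domino: "is_domino d \<Longrightarrow> card d = 2"
  by (auto simp: is_domino_def horizontal_domino_def vertical_domino_def)

lemma finite_ups: "young S \<Longrightarrow> finite (ups S)"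
  by (rule finite_subset[OF _ finite_young_above[of S 2]]) (auto simp: ups_def card_domino)

lemma finite_downs: "young S \<Longrightarrow> finite (downs S)"
  by (rule finite_subset[of _ "Pow S"]) (auto simp: downs_def young_finite)

lemma ups_iff_downs: "young S \<Longrightarrow> young A \<Longrightarrow> A \<in> ups S \<longleftrightarrow> S \<in> downs A"
  by (simp add: ups_def downs_def)

lemma downs_young: "B \<in> downs S \<Longrightarrow> young B"
  and ups_young: "A \<in> ups S \<Longrightarrow> young A"
  by (auto simp: ups_def downs_def)

abbreviation hdom :: "nat \<Rightarrow> nat \<Rightarrow> cell set" where "hdom i j \<equiv> {(i, j), (i, Suc j)}"
abbreviation vdom :: "nat \<Rightarrow> nat \<Rightarrow> cell set" where "vdom i j \<equiv> {(i, j), (Suc i, j)}"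

lemma is_domino_cases:
  assumes "is_domino d"
  obtains i j where "d = hdom i j" | i j where "d = vdom i j"
  using assms by (auto simp: is_domino_def horizontal_domino_def vertical_domino_def)

lemma is_domino_hdom [simp]: "is_domino (hdom i j)"
  and is_domino_vdom [simp]: "is_domino (vdom i j)"
  by (auto simp: is_domino_def horizontal_domino_def vertical_domino_def)

lemma vertical_vdom [simp]: "vertical_domino (vdom i j)"
  and not_vertical_hdom [simp]: "\<not> vertical_domino (hdom i j)"
  by (auto simp: vertical_domino_def doubleton_eq_iff)

abbreviation block :: "nat \<Rightarrow> nat \<Rightarrow> cell set" where
  "block i j \<equiv> {(i, j), (i, Suc j), (Suc i, j), (Suc i, Suc j)}"

text \<open>The removed dominoes are closed to the south-east inside \<open>A\<close>. Hence two of
  the same orientation that meet must coincide, and two of different orientation can meet only in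
  the last cell of both.\<close>

lemma down_pair:
  assumes A: "young A" and S: "S \<in> downs A" and B: "B \<in> downs A" and "S \<noteq> B"
  shows "(A - S) \<inter> (A - B) = {} \<or>
    (\<exists>i j. A - S = hdom (Suc i) j \<and> A - B = vdom i (Suc j)) \<or>
    (\<exists>i j. A - S = vdom i (Suc j) \<and> A - B = hdom (Suc i) j)"
proof (rule disjCI)
  assume ne: "\<not> ((\<exists>i j. A - S = hdom (Suc i) j \<and> A - B = vdom i (Suc j)) \<or>
    (\<exists>i j. A - S = vdom i (Suc j) \<and> A - B = hdom (Suc i) j))"
  have pos: "1 \<le> i \<and> 1 \<le> j" if "(i, j) \<in> A - S \<or> (i, j) \<in> A - B" for i j
    using that young_pos[OF A] by blast
  have up: "(i', j') \<in> A - T" if "T = S \<or> T = B" "(i, j) \<in> A - T" "(i', j') \<in> A" "i \<le> i'" "j \<le> j'"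
      for i j i' j' T
    using that young_up[of T i j i' j'] pos[of i j] S B by (auto simp: downs_def)
  have S': "is_domino (A - S)" "S = A - (A - S)" and B': "is_domino (A - B)" "B = A - (A - B)"
    using S B by (auto simp: downs_def)
  have d: "A - S \<noteq> A - B" using S' B' \<open>S \<noteq> B\<close> by metis
  have upS: "(i', j') \<in> A - S" if "(i, j) \<in> A - S" "(i', j') \<in> A - B" "i \<le> i'" "j \<le> j'"
      for i j i' j'
    using up[of S] that by blast
  have upB: "(i', j') \<in> A - B" if "(i, j) \<in> A - B" "(i', j') \<in> A - S" "i \<le> i'" "j \<le> j'"
      for i j i' j'
    using up[of B] that by blast
  show "(A - S) \<inter> (A - B) = {}"
    using S'(1)
  proof (cases rule: is_domino_cases)
    case (1 i j)
    note dS = this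
    show ?thesis using B'(1)
    proof (cases rule: is_domino_cases)
      case (1 i' j')
      show ?thesis
        using d upS[of i j i' "Suc j'"] upS[of i j i' j'] upB[of i' j' i j]
          upB[of i' j' i "Suc j"] unfolding dS 1 by auto
    next
      case (2 i' j')
      show ?thesis
        using ne upS[of i j "Suc i'" j'] upS[of i "Suc j" "Suc i'" j'] upB[of i' j' i "Suc j"]
          upB[of "Suc i'" j' i "Suc j"] unfolding dS 2 by auto
    qed
  next
    case (2 i j)
    note dS = this
    show ?thesis using B'(1)
    proof (cases rule: is_domino_cases)
      case (1 i' j')
      show ?thesis
        using ne upB[of i' j' "Suc i" j] upB[of i' "Suc j'" "Suc i" j] upS[of i j i' "Suc j'"]
          upS[of "Suc i" j i' "Suc j'"] unfolding dS 1 by auto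
    next
      case (2 i' j')
      show ?thesis
        using d upS[of i j "Suc i'" j'] upS[of i j i' j'] upB[of i' j' i j]
          upB[of i' j' "Suc i" j] unfolding dS 2 by auto
    qed
  qed
qed

text \<open>Dually, the added dominoes are closed to the north-west outside \<open>C\<close>, so
  those of different orientation can meet only in the first cell of both.\<close>

lemma up_pair:
  assumes C: "young C" and S: "S \<in> ups C" and B: "B \<in> ups C" and "S \<noteq> B"
  shows "(S - C) \<inter> (B - C) = {} \<or>
    (\<exists>i j. S - C = hdom i j \<and> B - C = vdom i j) \<or>
    (\<exists>i j. S - C = vdom i j \<and> B - C = hdom i j)"
proof (rule disjCI)
  assume ne: "\<not> ((\<exists>i j. S - C = hdom i j \<and> B - C = vdom i j) \<or>
    (\<exists>i j. S - C = vdom i j \<and> B - C = hdom i j))"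
  have pos: "1 \<le> i \<and> 1 \<le> j" if "(i, j) \<in> S - C \<or> (i, j) \<in> B - C" for i j
    using that young_pos S B by (fastforce simp: ups_def)
  have S': "is_domino (S - C)" "S = C \<union> (S - C)" and B': "is_domino (B - C)" "B = C \<union> (B - C)"
    using S B by (auto simp: ups_def)
  have d: "S - C \<noteq> B - C" using S' B' \<open>S \<noteq> B\<close> by metis
  have dnS: "(i', j') \<in> S - C" if "(i, j) \<in> S - C" "(i', j') \<in> B - C" "i' \<le> i" "j' \<le> j"
      for i j i' j'
    using that young_down[OF ups_young[OF S], of i j i' j'] pos[of i' j'] by auto
  have dnB: "(i', j') \<in> B - C" if "(i, j) \<in> B - C" "(i', j') \<in> S - C" "i' \<le> i" "j' \<le> j"
      for i j i' j'
    using that young_down[OF ups_young[OF B], of i j i' j'] pos[of i' j'] by auto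
  show "(S - C) \<inter> (B - C) = {}"
    using S'(1)
  proof (cases rule: is_domino_cases)
    case (1 i j)
    note dS = this
    show ?thesis using B'(1)
    proof (cases rule: is_domino_cases)
      case (1 i' j')
      show ?thesis
        using d dnS[of i "Suc j" i' "Suc j'"] dnS[of i "Suc j" i' j'] dnB[of i' "Suc j'" i j]
          dnB[of i' "Suc j'" i "Suc j"] unfolding dS 1 by auto
    next
      case (2 i' j')
      show ?thesis
        using ne dnS[of i j i' j'] dnS[of i "Suc j" i' j'] dnB[of i' j' i j] dnB[of "Suc i'" j' i
          j] unfolding dS 2 by auto
    qed
  next
    case (2 i j)
    note dS = this
    show ?thesis using B'(1)
    proof (cases rule: is_domino_cases)
      case (1 i' j')
      show ?thesis
        using ne dnB[of i' j' i j] dnB[of i' "Suc j'" i j] dnS[of i j i' j'] dnS[of "Suc i" j i'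
          j'] unfolding dS 1 by auto
    next
      case (2 i' j')
      show ?thesis
        using d dnS[of "Suc i" j "Suc i'" j'] dnS[of "Suc i" j i' j'] dnB[of "Suc i'" j' i j]
          dnB[of "Suc i'" j' "Suc i" j] unfolding dS 2 by auto
    qed
  qed
qed

text \<open>If \<open>S \<noteq> B\<close> have a common successor, the two removed dominoes are disjoint or overlap in the
  last cell of a 2-by-2 block; if they have a common predecessor, the two added dominoes are
  disjoint or overlap in the first cell of such a block. \<open>join\<close> and \<open>meet\<close> are that successor and predecessor:
  the exceptional cell is present exactly when the differences are single cells.\<close>

definition join :: "cell set \<Rightarrow> cell set \<Rightarrow> cell set" where
  "join S B = S \<union> B \<union>
     {(max i i', max j j') | i j i' j'. S - B = {(i, j)} \<and> B - S = {(i', j')}}"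

definition meet :: "cell set \<Rightarrow> cell set \<Rightarrow> cell set" where
  "meet S B = S \<inter> B -
     {(min i i', min j j') | i j i' j'. S - B = {(i, j)} \<and> B - S = {(i', j')}}"

lemma join_commute: "join S B = join B S"
proof -
  have "{(max i i', max j j') | i j i' j'. S - B = {(i, j)} \<and> B - S = {(i', j')}}
      = {(max i i', max j j') | i j i' j'. B - S = {(i, j)} \<and> S - B = {(i', j')}}"
    by (intro Collect_cong) (metis max.commute)
  then show ?thesis by (simp add: join_def Un_commute)
qed

lemma meet_commute: "meet S B = meet B S"
proof -
  have "{(min i i', min j j') | i j i' j'. S - B = {(i, j)} \<and> B - S = {(i', j')}}
      = {(min i i', min j j') | i j i' j'. B - S = {(i, j)} \<and> S - B = {(i', j')}}"
    by (intro Collect_cong) (metis min.commute)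
  then show ?thesis by (simp add: meet_def Int_commute)
qed

lemma domino_not_singleton: "\<not> is_domino {c}"
  using card_domino[of "{c}"] by auto

text \<open>The exceptional cell occurs only for one-element differences, and a domino has two
  cells.\<close>

lemma join_meet_dominoes:
  assumes "is_domino (S - B)"
  shows "join S B = S \<union> B" "meet S B = S \<inter> B"
  using assms domino_not_singleton by (auto simp: join_def meet_def)

lemma join_meet_cells:
  assumes "S - B = {(i, Suc j)}" "B - S = {(Suc i, j)}"
  shows "join S B = insert (Suc i, Suc j) (S \<union> B)" "meet S B = S \<inter> B - {(i, j)}"
  unfolding join_def meet_def assms by auto

text \<open>Both removals extend to the removal of a whole 2-by-2 block from \<open>A\<close>. The
  completing domino has the orientation of the one removed first, moved one step north or
  west.\<close>

lemma down_block:
  assumes A: "young A" and S: "S \<in> downs A" and B: "B \<in> downs A"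
    and dS: "A - S = hdom (Suc i) j" and dB: "A - B = vdom i (Suc j)"
  shows "join S B = A" "meet S B \<in> downs S" "meet S B \<in> downs B"
    "S - meet S B = hdom i j" "B - meet S B = vdom i j"
proof -
  have yS: "young S" "S \<subseteq> A" and yB: "young B" "B \<subseteq> A" using S B by (auto simp: downs_def)
  have mem: "(Suc i, j) \<in> A" "(Suc i, Suc j) \<in> A" "(i, Suc j) \<in> A"
    "(Suc i, j) \<notin> S" "(Suc i, Suc j) \<notin> S" "(i, Suc j) \<notin> B" "(Suc i, Suc j) \<notin> B"
    using eqset_imp_iff[OF dS] eqset_imp_iff[OF dB] by auto
  have "S = A - (A - S)" "B = A - (A - B)" using yS yB by auto
  then have S_eq: "S = A - hdom (Suc i) j" and B_eq: "B = A - vdom i (Suc j)"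
    unfolding dS dB by simp_all
  have pos: "1 \<le> i" "1 \<le> j" using young_pos[OF A mem(1)] young_pos[OF A mem(3)] by auto
  have ij: "(i, j) \<in> A" using young_down[OF A mem(2), of i j] pos by simp
  have SB: "S - B = {(i, Suc j)}" and BS: "B - S = {(Suc i, j)}"
    unfolding S_eq B_eq using mem by auto
  note jm = join_meet_cells[OF SB BS]
  show "join S B = A" unfolding jm unfolding S_eq B_eq using mem by auto
  have m: "meet S B = A - block i j" unfolding jm unfolding S_eq B_eq by auto
  have y: "young (meet S B)"
  proof (rule youngI)
    show "finite (meet S B)" unfolding m using young_finite[OF A] by simp
    show "1 \<le> a \<and> 1 \<le> b" if "(a, b) \<in> meet S B" for a b
      using that young_pos[OF A] unfolding m by blast
    fix a b a' b' assume ab: "(a, b) \<in> meet S B" "1 \<le> a'" "a' \<le> a" "1 \<le> b'" "b' \<le> b"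
    have abA: "(a, b) \<in> A" "(a, b) \<in> S" "(a, b) \<in> B" using ab(1) yS(2) unfolding jm by auto
    have "(a', b') \<in> A" using young_down[OF A abA(1)] ab by blast
    \<comment> \<open>South-east of \<open>(i, j)\<close>, a cell in a later row would be missing
      from \<open>S\<close> and one in a later column would be missing from \<open>B\<close>; only
      \<open>(i, j)\<close> itself is left, and it was removed.\<close>
    moreover have "\<not> (i \<le> a \<and> j \<le> b)"
    proof
      assume ge: "i \<le> a \<and> j \<le> b"
      have "\<not> Suc i \<le> a" using young_up[OF yS(1) mem(4), of a b] pos ge abA by auto
      moreover have "\<not> Suc j \<le> b" using young_up[OF yB(1) mem(6), of a b] pos ge abA by auto
      ultimately have "(a, b) = (i, j)" using ge by auto
      then show False using ab(1) unfolding m by simp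
    qed
    ultimately show "(a', b') \<in> meet S B" unfolding m using ab by auto
  qed
  show hS: "S - meet S B = hdom i j" unfolding m unfolding S_eq using mem ij by auto
  show hB: "B - meet S B = vdom i j" unfolding m unfolding B_eq using mem ij by auto
  show "meet S B \<in> downs S" "meet S B \<in> downs B"
    unfolding downs_def mem_Collect_eq hS hB using y by (auto simp: jm)
qed

text \<open>Dual to \<open>down_block\<close>: the completion adds the whole block to
  \<open>C\<close>, the second domino being the first one moved one step south or east.\<close>

lemma up_block:
  assumes C: "young C" and S: "S \<in> ups C" and B: "B \<in> ups C"
    and dS: "S - C = hdom i j" and dB: "B - C = vdom i j"
  shows "meet S B = C" "join S B \<in> ups S" "join S B \<in> ups B"
    "join S B - S = hdom (Suc i) j" "join S B - B = vdom i (Suc j)"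
proof -
  have yS: "young S" "C \<subseteq> S" and yB: "young B" "C \<subseteq> B" using S B by (auto simp: ups_def)
  have "S = C \<union> (S - C)" "B = C \<union> (B - C)" using yS yB by auto
  then have S_eq: "S = C \<union> hdom i j" and B_eq: "B = C \<union> vdom i j"
    unfolding dS dB by simp_all
  have mem: "(i, j) \<notin> C" "(i, Suc j) \<notin> C" "(Suc i, j) \<notin> C"
    using eqset_imp_iff[OF dS] eqset_imp_iff[OF dB] by auto
  have pos: "1 \<le> i" "1 \<le> j" using young_pos[OF yS(1), of i j] S_eq by auto
  have c: "(Suc i, Suc j) \<notin> C" using young_up[OF C mem(1)] pos by simp
  have SB: "S - B = {(i, Suc j)}" and BS: "B - S = {(Suc i, j)}"
    unfolding S_eq B_eq using mem by auto
  note jm = join_meet_cells[OF SB BS]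
  show "meet S B = C" unfolding jm unfolding S_eq B_eq using mem by auto
  have m: "join S B = C \<union> block i j" unfolding jm unfolding S_eq B_eq by auto
  have y: "young (join S B)"
  proof (rule youngI)
    show "finite (join S B)" unfolding m using young_finite[OF C] by simp
    show "1 \<le> a \<and> 1 \<le> b" if "(a, b) \<in> join S B" for a b
      using that young_pos[OF C, of a b] pos unfolding m by auto
    fix a b a' b' assume ab: "(a, b) \<in> join S B" "1 \<le> a'" "a' \<le> a" "1 \<le> b'" "b' \<le> b"
    show "(a', b') \<in> join S B"
    \<comment> \<open>Only the new corner needs an argument, \<open>S\<close> and \<open>B\<close>
      being diagrams. Any other cell north-west of it lies north-west of the last cell of
      \<open>S - C\<close> or of \<open>B - C\<close>.\<close>
    proof (cases "(a, b) = (Suc i, Suc j)")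
      case False
      then have "(a, b) \<in> S \<or> (a, b) \<in> B" using ab unfolding jm by auto
      then show ?thesis unfolding jm using young_down[OF yS(1)] young_down[OF yB(1)] ab by blast
    next
      case True
      then consider "a' \<le> i" "b' \<le> Suc j" | "a' \<le> Suc i" "b' \<le> j" | "(a', b') = (Suc i, Suc j)"
        using ab by fastforce
      then show ?thesis
      proof cases
        case 1
        then show ?thesis unfolding jm using young_down[OF yS(1), of i "Suc j"] ab S_eq by auto
      next
        case 2
        then show ?thesis unfolding jm using young_down[OF yB(1), of "Suc i" j] ab B_eq by auto
      qed (simp add: jm)
    qed
  qed
  show hS: "join S B - S = hdom (Suc i) j" unfolding m unfolding S_eq using mem c by auto
  show hB: "join S B - B = vdom i (Suc j)" unfolding m unfolding B_eq using mem c by auto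
  show "join S B \<in> ups S" "join S B \<in> ups B"
    unfolding ups_def mem_Collect_eq hS hB using y by (auto simp: jm)
qed

section \<open>Weights of single dominoes\<close>

definition vert_exp :: "cell set \<Rightarrow> rat" where
  "vert_exp d = (if vertical_domino d then 1 / 2 else 0)"

text \<open>The contribution of one domino to a summand of \<open>W_pos\<close>;
  \<open>down_wt\<close> is its counterpart for \<open>W_neg\<close>. They are inverse in
  \<open>x\<close> and \<open>y\<close> but not in \<open>q\<close>, so their product is 1 on a
  horizontal and \<open>q\<close> on a vertical domino.\<close>

definition up_wt :: "cell set \<Rightarrow> laurent" where
  "up_wt d = mon (1 - int (even_row_cells d)) (1 - int (even_col_cells d)) (vert_exp d)"

definition down_wt :: "cell set \<Rightarrow> laurent" where
  "down_wt d = mon (int (even_row_cells d) - 1) (int (even_col_cells d) - 1) (vert_exp d)"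

lemma mon_mult: "mon a b c * mon a' b' c' = mon (a + a') (b + b') (c + c')"
  by (simp add: mon_def mult_single)

lemma mon_0 [simp]: "mon 0 0 0 = 1"
proof -
  have "(0, 0, 0) = (0 :: int \<times> int \<times> rat)" by (simp add: zero_prod_def)
  then show ?thesis by (simp add: mon_def)
qed

text \<open>The exponent of \<open>x\<close> in the up-weight of a horizontal domino in row
  \<open>r\<close>, and of \<open>y\<close> for a vertical one in column \<open>r\<close>. Its
  change of sign from \<open>r\<close> to \<open>r + 1\<close> equates the weight of a removal with
  that of an addition one line further.\<close>

definition par_sign :: "nat \<Rightarrow> int" where
  "par_sign r = (if odd r then 1 else - 1)"

lemma par_sign_Suc [simp]: "par_sign (Suc r) = - par_sign r"
  by (simp add: par_sign_def)

lemma even_row_cells_hdom: "int (even_row_cells (hdom i j)) = 1 - par_sign i"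
proof -
  have "{(a, b) \<in> hdom i j. even a} = (if even i then hdom i j else {})" by auto
  then show ?thesis by (simp add: even_row_cells_def par_sign_def)
qed

lemma even_col_cells_hdom: "even_col_cells (hdom i j) = 1"
proof -
  have "{(a, b) \<in> hdom i j. even b} = (if even j then {(i, j)} else {(i, Suc j)})" by auto
  then show ?thesis by (simp add: even_col_cells_def)
qed

lemma even_col_cells_vdom: "int (even_col_cells (vdom i j)) = 1 - par_sign j"
proof -
  have "{(a, b) \<in> vdom i j. even b} = (if even j then vdom i j else {})" by auto
  then show ?thesis by (simp add: even_col_cells_def par_sign_def)
qed

lemma even_row_cells_vdom: "even_row_cells (vdom i j) = 1"
proof -
  have "{(a, b) \<in> vdom i j. even a} = (if even i then {(i, j)} else {(Suc i, j)})" by auto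
  then show ?thesis by (simp add: even_row_cells_def)
qed

text \<open>A horizontal domino has exactly one cell in an even column and 0 or 2 cells in even
  rows, so its weight depends on its row alone. Vertical dominoes behave symmetrically, apart from
  the square root of \<open>q\<close>.\<close>

lemma domino_wt:
  "up_wt (hdom i j) = mon (par_sign i) 0 0" "down_wt (hdom i j) = mon (- par_sign i) 0 0"
  "up_wt (vdom i j) = mon 0 (par_sign j) (1 / 2)" "down_wt (vdom i j) =
      mon 0 (- par_sign j) (1 / 2)"
  by (simp_all add: up_wt_def down_wt_def even_row_cells_hdom even_col_cells_hdom
      even_row_cells_vdom even_col_cells_vdom vert_exp_def)

text \<open>Disjoint dominoes keep their weights when the order is exchanged. In the block case each
  domino moves by one line, which flips the sign of its exponent, and its up-weight and down-weight
  are interchanged, which flips it back.\<close>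

lemma diamond_down:
  assumes A: "young A" and S: "S \<in> downs A" and B: "B \<in> downs A" and "S \<noteq> B"
  shows "join S B = A \<and> meet S B \<in> downs S \<and> meet S B \<in> downs B \<and>
    up_wt (A - S) * down_wt (A - B) = down_wt (S - meet S B) * up_wt (B - meet S B)"
  using down_pair[OF assms]
proof (elim disjE exE conjE)
  assume "(A - S) \<inter> (A - B) = {}"
  then have *: "S - B = A - B" "B - S = A - S" "S \<union> B = A"
    using S B by (auto simp: downs_def)
  have "is_domino (S - B)" unfolding * using B by (simp add: downs_def)
  note jm = join_meet_dominoes[OF this]
  have "S - S \<inter> B = A - B" "B - S \<inter> B = A - S" using * by auto
  then show ?thesis unfolding jm
    using S B young_Int[of S B] *(3) by (auto simp: downs_def mult.commute)
next
  fix i j assume "A - S = hdom (Suc i) j" "A - B = vdom i (Suc j)"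
  then show ?thesis using down_block[OF A S B] by (simp add: domino_wt mon_mult)
next
  fix i j assume "A - S = vdom i (Suc j)" "A - B = hdom (Suc i) j"
  then show ?thesis using down_block[OF A B S]
    by (simp add: domino_wt mon_mult join_commute[of S B] meet_commute[of S B])
qed

text \<open>Supplies the inverse direction of the bijection in \<open>off_diagonal_eq\<close>; the
  weights are compared in \<open>diamond_down\<close>.\<close>

lemma diamond_up:
  assumes C: "young C" and S: "S \<in> ups C" and B: "B \<in> ups C" and "S \<noteq> B"
  shows "meet S B = C \<and> join S B \<in> ups S \<and> join S B \<in> ups B"
  using up_pair[OF assms]
proof (elim disjE exE conjE)
  assume "(S - C) \<inter> (B - C) = {}"
  then have *: "S - B = S - C" "B - S = B - C" "S \<inter> B = C"
    using S B by (auto simp: ups_def)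
  have "is_domino (S - B)" unfolding * using S by (simp add: ups_def)
  note jm = join_meet_dominoes[OF this]
  have "S \<union> B - S = B - C" "S \<union> B - B = S - C" using * by auto
  then show ?thesis unfolding jm
    using S B young_Un[of S B] *(3) by (auto simp: ups_def)
next
  fix i j assume "S - C = hdom i j" "B - C = vdom i j"
  then show ?thesis using up_block[OF C S B] by simp
next
  fix i j assume "S - C = vdom i j" "B - C = hdom i j"
  then show ?thesis using up_block[OF C B S]
    by (simp add: join_commute[of S B] meet_commute[of S B])
qed

section \<open>The operators for adding and removing a domino, and their commutator\<close>

definition up_op :: "(cell set \<Rightarrow> laurent) \<Rightarrow> cell set \<Rightarrow> laurent" where
  "up_op f S = (\<Sum>A\<in>ups S. up_wt (A - S) * f A)"

definition down_op :: "(cell set \<Rightarrow> laurent) \<Rightarrow> cell set \<Rightarrow> laurent" where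
  "down_op f S = (\<Sum>B\<in>downs S. down_wt (S - B) * f B)"

text \<open>Walks up and then down are split by whether they return to \<open>S\<close>. The
  returning ones give a multiple of \<open>f S\<close>; the others will be matched with walks down
  and then up.\<close>

lemma up_op_down_op_split:
  assumes S: "young S"
  shows "up_op (down_op f) S =
    (\<Sum>(A, B) | A \<in> ups S \<and> B \<in> downs A \<and> B \<noteq> S. up_wt (A - S) * down_wt (A - B) * f B)
    + (\<Sum>A\<in>ups S. up_wt (A - S) * down_wt (A - S)) * f S"
proof -
  have "down_op f A = (\<Sum>B\<in>downs A - {S}. down_wt (A - B) * f B) + down_wt (A - S) * f S"
    if "A \<in> ups S" for A
  proof -
    have "S \<in> downs A" using that S ups_iff_downs ups_young by blast
    then show ?thesis unfolding down_op_def
      using sum.remove[OF finite_downs[OF ups_young[OF that]], of S] by (simp add: add.commute)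
  qed
  then have "up_op (down_op f) S = (\<Sum>A\<in>ups S. up_wt (A - S) * (\<Sum>B\<in>downs A - {S}. down_wt (A - B) *
      f B)
      + up_wt (A - S) * down_wt (A - S) * f S)"
    unfolding up_op_def by (simp add: distrib_left mult.assoc)
  also have "\<dots> = (\<Sum>A\<in>ups S. \<Sum>B\<in>downs A - {S}. up_wt (A - S) * down_wt (A - B) * f B)
      + (\<Sum>A\<in>ups S. up_wt (A - S) * down_wt (A - S)) * f S"
    by (simp add: sum.distrib sum_distrib_left sum_distrib_right mult.assoc)
  also have "(\<Sum>A\<in>ups S. \<Sum>B\<in>downs A - {S}. up_wt (A - S) * down_wt (A - B) * f B)
    = (\<Sum>(A, B) | A \<in> ups S \<and> B \<in> downs A \<and> B \<noteq> S. up_wt (A - S) * down_wt (A - B) * f B)"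
    by (subst sum.Sigma) (auto intro!: sum.cong finite_ups S finite_downs dest: ups_young)
  finally show ?thesis .
qed

lemma down_op_U_split:
  assumes S: "young S"
  shows "down_op (up_op f) S =
    (\<Sum>(C, B) | C \<in> downs S \<and> B \<in> ups C \<and> B \<noteq> S. down_wt (S - C) * up_wt (B - C) * f B)
    + (\<Sum>C\<in>downs S. down_wt (S - C) * up_wt (S - C)) * f S"
proof -
  have "up_op f C = (\<Sum>B\<in>ups C - {S}. up_wt (B - C) * f B) + up_wt (S - C) * f S"
    if "C \<in> downs S" for C
  proof -
    have "S \<in> ups C" using that S ups_iff_downs downs_young by blast
    then show ?thesis unfolding up_op_def
      using sum.remove[OF finite_ups[OF downs_young[OF that]], of S] by (simp add: add.commute)
  qed
  then have "down_op (up_op f) S = (\<Sum>C\<in>downs S. down_wt (S - C) * (\<Sum>B\<in>ups C - {S}. up_wt (B - C) *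
      f B)
      + down_wt (S - C) * up_wt (S - C) * f S)"
    unfolding down_op_def by (simp add: distrib_left mult.assoc)
  also have "\<dots> = (\<Sum>C\<in>downs S. \<Sum>B\<in>ups C - {S}. down_wt (S - C) * up_wt (B - C) * f B)
      + (\<Sum>C\<in>downs S. down_wt (S - C) * up_wt (S - C)) * f S"
    by (simp add: sum.distrib sum_distrib_left sum_distrib_right mult.assoc)
  also have "(\<Sum>C\<in>downs S. \<Sum>B\<in>ups C - {S}. down_wt (S - C) * up_wt (B - C) * f B)
    = (\<Sum>(C, B) | C \<in> downs S \<and> B \<in> ups C \<and> B \<noteq> S. down_wt (S - C) * up_wt (B - C) * f B)"
    by (subst sum.Sigma) (auto intro!: sum.cong finite_downs S finite_ups dest: downs_young)
  finally show ?thesis .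
qed

text \<open>The endpoint \<open>B\<close> is kept, and the intermediate diagrams determine each
  other by \<open>A = join S B\<close> and \<open>C = meet S B\<close>.\<close>

lemma off_diagonal_eq:
  assumes S: "young S"
  shows "(\<Sum>(A, B) | A \<in> ups S \<and> B \<in> downs A \<and> B \<noteq> S. up_wt (A - S) * down_wt (A - B) * f B)
    = (\<Sum>(C, B) | C \<in> downs S \<and> B \<in> ups C \<and> B \<noteq> S. down_wt (S - C) * up_wt (B - C) * f B)"
proof -
  have down: "join S B = A \<and> meet S B \<in> downs S \<and> B \<in> ups (meet S B) \<and>
      down_wt (S - meet S B) * up_wt (B - meet S B) = up_wt (A - S) * down_wt (A - B)"
    if AB: "A \<in> ups S" "B \<in> downs A" "B \<noteq> S" for A B
  proof -
    have A: "young A" and B: "young B" and SA: "S \<in> downs A"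
      using AB S ups_iff_downs ups_young downs_young by blast+
    show ?thesis
      using diamond_down[OF A SA AB(2) AB(3)[symmetric]] B ups_iff_downs downs_young by metis
  qed
  have up: "meet S B = C \<and> join S B \<in> ups S \<and> B \<in> downs (join S B)"
    if CB: "C \<in> downs S" "B \<in> ups C" "B \<noteq> S" for C B
  proof -
    have C: "young C" and B: "young B" and SC: "S \<in> ups C"
      using CB S ups_iff_downs ups_young downs_young by blast+
    show ?thesis
      using diamond_up[OF C SC CB(2) CB(3)[symmetric]] B ups_iff_downs ups_young by metis
  qed
  show ?thesis
    by (rule sum.reindex_bij_witness[where i = "\<lambda>(C, B). (join S B, B)" and j =
      "\<lambda>(A, B). (meet S B, B)"])
      (clarsimp; metis down up)+
qed

lemma up_op_down_op_commute:
  assumes S: "young S"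
  shows "up_op (down_op f) S = down_op (up_op f) S +
    ((\<Sum>A\<in>ups S. up_wt (A - S) * down_wt (A - S)) - (\<Sum>C\<in>downs S. down_wt (S - C) * up_wt (S - C)))
        * f S"
  unfolding up_op_down_op_split[OF S] down_op_U_split[OF S] off_diagonal_eq[OF S]
    by (simp add: algebra_simps)

subsection \<open>Balance of addable and removable dominoes\<close>

definition drop_rows :: "cell set \<Rightarrow> nat set" where
  "drop_rows S = {i. 1 \<le> i \<and> row_len S (Suc i) + 2 \<le> row_len S i}"

lemma finite_drop_rows:
  assumes "young S"
  shows "finite (drop_rows S)"
proof (rule finite_subset)
  show "drop_rows S \<subseteq> fst ` S"
  proof
    fix i assume "i \<in> drop_rows S"
    then have "(i, 1) \<in> S" by (simp add: drop_rows_def young_mem[OF assms])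
    then show "i \<in> fst ` S" by force
  qed
qed (simp add: young_finite[OF assms])

text \<open>An added horizontal domino must continue its row directly, and the row above must reach
  at least as far as its right half; in row 1 the latter is no constraint.\<close>

lemma hups_eq:
  assumes S: "young S"
  shows "{A \<in> ups S. horizontal_domino (A - S)} =
    (\<lambda>i. S \<union> hdom i (Suc (row_len S i))) ` insert 1 (Suc ` drop_rows S)" (is "?L = ?R")
proof (intro equalityI subsetI)
  fix A assume "A \<in> ?L"
  then obtain i j where A: "young A" "S \<subseteq> A" and d: "A - S = hdom i j"
    by (auto simp: ups_def horizontal_domino_def)
  have A_eq: "A = S \<union> hdom i j" using A(2) d by auto
  have mem: "(i, j) \<in> A" "(i, Suc j) \<in> A" "(i, j) \<notin> S"
    using eqset_imp_iff[OF d] by auto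
  have pos: "1 \<le> i" "1 \<le> j" using young_pos[OF A(1) mem(1)] by auto
  have "j \<le> Suc (row_len S i)"
  proof (cases "j = 1")
    case False
    then have "(i, j - 1) \<in> A" using young_down[OF A(1) mem(1), of i "j - 1"] pos by auto
    then have "(i, j - 1) \<in> S" using False pos by (auto simp: A_eq)
    then show ?thesis using young_mem[OF S] by auto
  qed simp
  moreover have "\<not> j \<le> row_len S i" using mem(3) pos young_mem[OF S] by auto
  ultimately have j: "j = Suc (row_len S i)" by simp
  have "i \<in> insert 1 (Suc ` drop_rows S)"
  proof (cases "i = 1")
    case False
    then have i: "1 \<le> i - 1" "Suc (i - 1) = i" using pos by auto
    have "(i - 1, Suc j) \<in> A" using young_down[OF A(1) mem(2), of "i - 1" "Suc j"] i by auto
    then have "(i - 1, Suc j) \<in> S" using i by (auto simp: A_eq)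
    then have "row_len S i + 2 \<le> row_len S (i - 1)" using young_mem[OF S] j by auto
    then have "i - 1 \<in> drop_rows S" using i by (simp add: drop_rows_def)
    then show ?thesis using i(2) by (metis imageI insertCI)
  qed simp
  then show "A \<in> ?R" using A_eq j by blast
next
  fix A assume "A \<in> ?R"
  then obtain i where i: "i \<in> insert 1 (Suc ` drop_rows S)" and A: "A =
      S \<union> hdom i (Suc (row_len S i))"
    by blast
  have d: "A - S = hdom i (Suc (row_len S i))" unfolding A using young_mem[OF S] by auto
  have i1: "1 \<le> i" using i by auto
  have above: "Suc (Suc (row_len S i)) \<le> row_len S i'" if "1 \<le> i'" "i' < i" for i'
  proof -
    have "i - 1 \<in> drop_rows S" using i that by auto
    then have "row_len S i + 2 \<le> row_len S (i - 1)" using i1 by (simp add: drop_rows_def)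
    also have "\<dots> \<le> row_len S i'" using that by (intro row_len_antimono[OF S]) auto
    finally show ?thesis by simp
  qed
  have "young A"
  proof (rule youngI)
    show "finite A" using young_finite[OF S] by (simp add: A)
    show "1 \<le> a \<and> 1 \<le> b" if "(a, b) \<in> A" for a b
      using that young_pos[OF S] i1 by (auto simp: A)
    fix a b a' b' assume ab: "(a, b) \<in> A" "1 \<le> a'" "a' \<le> a" "1 \<le> b'" "b' \<le> b"
    show "(a', b') \<in> A"
    proof (cases "(a, b) \<in> S")
      case True
      then show ?thesis using young_down[OF S True] ab by (simp add: A)
    next
      case False
      then have "a = i" "b \<le> Suc (Suc (row_len S i))" using ab(1) by (auto simp: A)
      then show ?thesis using ab above[of a'] by (cases "a' = i") (auto simp: A young_mem[OF S])
    qed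
  qed
  then show "A \<in> ?L" using d by (auto simp: ups_def A horizontal_domino_def)
qed

text \<open>A removable horizontal domino ends its row, and the next row must stop short of its left
  cell.\<close>

lemma hdowns_eq:
  assumes S: "young S"
  shows "{B \<in> downs S. horizontal_domino (S - B)} =
    (\<lambda>i. S - hdom i (row_len S i - 1)) ` drop_rows S" (is "?L = ?R")
proof (intro equalityI subsetI)
  fix B assume "B \<in> ?L"
  then obtain i j where B: "young B" "B \<subseteq> S" and d: "S - B = hdom i j"
    by (auto simp: downs_def horizontal_domino_def)
  have B_eq: "B = S - hdom i j" using B(2) d by auto
  have mem: "(i, j) \<in> S" "(i, Suc j) \<in> S" "(i, j) \<notin> B"
    using eqset_imp_iff[OF d] by auto
  have pos: "1 \<le> i" "1 \<le> j" using young_pos[OF S mem(1)] by auto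
  have "(i, Suc (Suc j)) \<notin> B" "(Suc i, j) \<notin> B"
    using young_up[OF B(1) mem(3)] pos by simp_all
  then have "(i, Suc (Suc j)) \<notin> S" "(Suc i, j) \<notin> S" by (auto simp: B_eq)
  then have r: "row_len S i = Suc j" "row_len S (Suc i) < j"
    using mem(2) pos young_mem[OF S] by auto
  then have "i \<in> drop_rows S" using pos by (simp add: drop_rows_def)
  moreover have "j = row_len S i - 1" using r by simp
  ultimately show "B \<in> ?R" unfolding B_eq by blast
next
  fix B assume "B \<in> ?R"
  then obtain i where i: "i \<in> drop_rows S" and B: "B = S - hdom i (row_len S i - 1)" by blast
  define j where "j = row_len S i - 1"
  have r: "row_len S i = Suc j" "row_len S (Suc i) < j" "1 \<le> i" "1 \<le> j"
    using i by (auto simp: drop_rows_def j_def)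
  note B = B[folded j_def]
  have d: "S - B = hdom i j" unfolding B using young_mem[OF S] r by auto
  have "young B"
  proof (rule youngI)
    show "finite B" using young_finite[OF S] by (simp add: B)
    show "1 \<le> a \<and> 1 \<le> b" if "(a, b) \<in> B" for a b
      using that young_pos[OF S] by (auto simp: B)
    fix a b a' b' assume ab: "(a, b) \<in> B" "1 \<le> a'" "a' \<le> a" "1 \<le> b'" "b' \<le> b"
    have abS: "(a, b) \<in> S" using ab(1) by (simp add: B)
    have "\<not> (i \<le> a \<and> j \<le> b)"
    proof
      assume ge: "i \<le> a \<and> j \<le> b"
      have b: "b \<le> row_len S a" using young_mem[OF S] abS by auto
      show False
      proof (cases "a = i")
        case True
        then show False using b ge r ab(1) by (auto simp: B le_Suc_eq)
      next
        case False
        then have "row_len S a \<le> row_len S (Suc i)" using ge by (intro row_len_antimono[OF S]) auto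
        then show False using b ge r by auto
      qed
    qed
    then show "(a', b') \<in> B" using young_down[OF S abS] ab by (auto simp: B)
  qed
  then show "B \<in> ?L" using d by (auto simp: downs_def B horizontal_domino_def)
qed

text \<open>A row of length at least two more than the next one allows both the removal of a horizontal
  domino from it and the addition of one to the next row; only the addition to row 1 is unpaired.\<close>

lemma horizontal_balance:
  fixes \<phi> \<psi> :: "cell set \<Rightarrow> 'a::comm_monoid_add"
  assumes S: "young S"
    and \<phi>: "\<And>i j. \<phi> (hdom i j) = g i" and \<psi>: "\<And>i j. \<psi> (hdom i j) = g (Suc i)"
  shows "(\<Sum>A | A \<in> ups S \<and> horizontal_domino (A - S). \<phi> (A - S)) =
    g 1 + (\<Sum>B | B \<in> downs S \<and> horizontal_domino (S - B). \<psi> (S - B))"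
proof -
  let ?a = "\<lambda>i. S \<union> hdom i (Suc (row_len S i))" and ?r = "\<lambda>i. S - hdom i (row_len S i - 1)"
  have a: "?a i - S = hdom i (Suc (row_len S i))" for i
    using young_mem[OF S] by auto
  have r: "S - ?r i = hdom i (row_len S i - 1)" if "i \<in> drop_rows S" for i
    using young_mem[OF S] that by (auto simp: drop_rows_def)
  have inj_a: "inj ?a"
  proof (rule injI)
    fix i i' assume "?a i = ?a i'"
    then have "hdom i (Suc (row_len S i)) = hdom i' (Suc (row_len S i'))"
      using a[of i] a[of i'] by simp
    then show "i = i'" by (auto simp: doubleton_eq_iff)
  qed
  have inj_r: "inj_on ?r (drop_rows S)"
  proof (rule inj_onI)
    fix i i' assume i: "i \<in> drop_rows S" "i' \<in> drop_rows S" and "?r i = ?r i'"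
    then have "hdom i (row_len S i - 1) = hdom i' (row_len S i' - 1)"
      using r[OF i(1)] r[OF i(2)] by simp
    then show "i = i'" by (auto simp: doubleton_eq_iff)
  qed
  have "(\<Sum>A | A \<in> ups S \<and> horizontal_domino (A - S). \<phi> (A - S)) =
      (\<Sum>i\<in>insert 1 (Suc ` drop_rows S). \<phi> (?a i - S))"
    unfolding hups_eq[OF S] by (rule sum.reindex[OF inj_on_subset[OF inj_a subset_UNIV], unfolded
      o_def])
  also have "\<dots> = (\<Sum>i\<in>insert 1 (Suc ` drop_rows S). g i)"
    by (simp only: a \<phi>)
  \<comment> \<open>Row 1 is not counted twice, because \<open>drop_rows\<close> contains no row
    0.\<close>
  also have "\<dots> = g 1 + (\<Sum>i\<in>Suc ` drop_rows S. g i)"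
    by (rule sum.insert) (simp_all add: finite_drop_rows[OF S], auto simp: drop_rows_def)
  also have "(\<Sum>i\<in>Suc ` drop_rows S. g i) = (\<Sum>i\<in>drop_rows S. g (Suc i))"
    by (simp add: sum.reindex)
  also have "\<dots> = (\<Sum>i\<in>drop_rows S. \<psi> (S - ?r i))"
    by (rule sum.cong) (simp_all only: r \<psi>)
  also have "\<dots> = (\<Sum>B | B \<in> downs S \<and> horizontal_domino (S - B). \<psi> (S - B))"
    unfolding hdowns_eq[OF S] by (rule sum.reindex[OF inj_r, unfolded o_def, symmetric])
  finally show ?thesis .
qed

section \<open>Conjugation, which carries the horizontal case to the vertical one\<close>

abbreviation conj_diag :: "cell set \<Rightarrow> cell set" where "conj_diag S \<equiv> prod.swap ` S"

lemma conj_diag_conj_diag: "conj_diag (conj_diag S) = S"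
  by (simp add: image_image)

lemma conj_diag_Diff: "conj_diag (A - B) = conj_diag A - conj_diag B"
  by (rule image_set_diff) simp

lemma young_conj_diag: "young S \<Longrightarrow> young (conj_diag S)"
proof (rule youngI)
  assume S: "young S"
  show "finite (conj_diag S)" using young_finite[OF S] by simp
  show "1 \<le> i \<and> 1 \<le> j" if "(i, j) \<in> conj_diag S" for i j using that young_pos[OF S] by auto
  show "(i', j') \<in> conj_diag S" if "(i, j) \<in> conj_diag S" "1 \<le> i'" "i' \<le> i" "1 \<le> j'" "j' \<le> j"
      for i j i' j'
    using that young_down[OF S, of j i j' i'] by force
qed

lemma horizontal_conj_diag: "horizontal_domino (conj_diag d) \<longleftrightarrow> vertical_domino d"
proof
  assume "horizontal_domino (conj_diag d)"
  then obtain i j where "conj_diag d = hdom i j" by (auto simp: horizontal_domino_def)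
  then have "d = conj_diag (hdom i j)" by (metis conj_diag_conj_diag)
  then show "vertical_domino d" by simp
next
  assume "vertical_domino d"
  then obtain i j where "d = vdom i j" by (auto simp: vertical_domino_def)
  then have "conj_diag d = hdom j i" by simp
  then show "horizontal_domino (conj_diag d)" unfolding horizontal_domino_def by auto
qed

lemma vertical_conj_diag: "vertical_domino (conj_diag d) \<longleftrightarrow> horizontal_domino d"
  using horizontal_conj_diag[of "conj_diag d"] by (simp add: conj_diag_conj_diag)

lemma is_domino_conj_diag: "is_domino (conj_diag d) \<longleftrightarrow> is_domino d"
  by (auto simp: is_domino_def horizontal_conj_diag vertical_conj_diag)

lemma conj_diag_subset: "conj_diag A \<subseteq> conj_diag B \<longleftrightarrow> A \<subseteq> B"
  by (simp add: inj_image_subset_iff)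

lemma ups_conj_diag: "A \<in> ups S \<Longrightarrow> conj_diag A \<in> ups (conj_diag S)"
  unfolding ups_def by (auto simp: young_conj_diag is_domino_conj_diag conj_diag_Diff[symmetric]
    conj_diag_subset)

lemma downs_conj_diag: "A \<in> downs S \<Longrightarrow> conj_diag A \<in> downs (conj_diag S)"
  unfolding downs_def by (auto simp: young_conj_diag is_domino_conj_diag conj_diag_Diff[symmetric]
    conj_diag_subset)

text \<open>Conjugation reduces this to \<open>horizontal_balance\<close> for
  \<open>conj_diag S\<close>. Columns become rows, so \<open>g\<close> stays the same.\<close>

lemma vertical_balance:
  fixes \<phi> \<psi> :: "cell set \<Rightarrow> 'a::comm_monoid_add"
  assumes S: "young S"
    and \<phi>: "\<And>i j. \<phi> (vdom i j) = g j" and \<psi>: "\<And>i j. \<psi> (vdom i j) = g (Suc j)"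
  shows "(\<Sum>A | A \<in> ups S \<and> vertical_domino (A - S). \<phi> (A - S)) =
    g 1 + (\<Sum>B | B \<in> downs S \<and> vertical_domino (S - B). \<psi> (S - B))"
proof -
  let ?\<phi> = "\<lambda>d. \<phi> (conj_diag d)" and ?\<psi> = "\<lambda>d. \<psi> (conj_diag d)"
  have up: "conj_diag A \<in> ups (conj_diag S) \<and> horizontal_domino (conj_diag A - conj_diag S) \<and>
      conj_diag (conj_diag A - conj_diag S) = A - S"
    if "A \<in> ups S" "vertical_domino (A - S)" for A
    using that ups_conj_diag by (simp add: conj_diag_Diff[symmetric] conj_diag_conj_diag
      horizontal_conj_diag)
  have up': "conj_diag A \<in> ups S \<and> vertical_domino (conj_diag A - S) \<and> conj_diag A - S =
      conj_diag (A - conj_diag S)"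
    if "A \<in> ups (conj_diag S)" "horizontal_domino (A - conj_diag S)" for A
    using that ups_conj_diag[OF that(1)]
      by (simp add: conj_diag_Diff conj_diag_conj_diag flip: horizontal_conj_diag)
  have down: "conj_diag A \<in> downs (conj_diag S) \<and> horizontal_domino (conj_diag S - conj_diag A) \<and>
      conj_diag (conj_diag S - conj_diag A) = S - A"
    if "A \<in> downs S" "vertical_domino (S - A)" for A
    using that downs_conj_diag by (simp add: conj_diag_Diff[symmetric] conj_diag_conj_diag
      horizontal_conj_diag)
  have down': "conj_diag A \<in> downs S \<and> vertical_domino (S - conj_diag A) \<and> S - conj_diag A =
      conj_diag (conj_diag S - A)"
    if "A \<in> downs (conj_diag S)" "horizontal_domino (conj_diag S - A)" for A
    using that downs_conj_diag[OF that(1)]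
      by (simp add: conj_diag_Diff conj_diag_conj_diag flip: horizontal_conj_diag)
  have "(\<Sum>A | A \<in> ups S \<and> vertical_domino (A - S). \<phi> (A - S)) =
      (\<Sum>A | A \<in> ups (conj_diag S) \<and> horizontal_domino (A - conj_diag S). ?\<phi> (A - conj_diag S))"
    by (rule sum.reindex_bij_witness[where i = conj_diag and j =
      conj_diag]) (auto simp only: mem_Collect_eq up up' conj_diag_conj_diag vertical_conj_diag)
  also have "\<dots> = g 1 + (\<Sum>B | B \<in> downs (conj_diag S) \<and>
      horizontal_domino (conj_diag S - B). ?\<psi> (conj_diag S - B))"
    by (rule horizontal_balance[OF young_conj_diag[OF S]]) (simp_all add: \<phi> \<psi>)
  also have "(\<Sum>B | B \<in> downs (conj_diag S) \<and> horizontal_domino (conj_diag S - B). ?\<psi> (conj_diag S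
      - B)) =
      (\<Sum>B | B \<in> downs S \<and> vertical_domino (S - B). \<psi> (S - B))"
    by (rule sum.reindex_bij_witness[where i = conj_diag and j =
      conj_diag]) (auto simp only: mem_Collect_eq down down' conj_diag_conj_diag vertical_conj_diag)
  finally show ?thesis .
qed

lemma domino_sum_split:
  assumes "finite X" "\<And>A. A \<in> X \<Longrightarrow> is_domino (d A)"
  shows "sum f X = (\<Sum>A | A \<in> X \<and> horizontal_domino (d A). f A) + (\<Sum>A | A \<in> X \<and>
      vertical_domino (d A). f A)"
proof -
  have nhv: "\<not> (horizontal_domino e \<and> vertical_domino e)" for e
    by (auto simp: horizontal_domino_def)
  have "X = {A \<in> X. horizontal_domino (d A)} \<union> {A \<in> X. vertical_domino (d A)}"
    using assms(2) by (auto simp: is_domino_def)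
  then have "sum f X = sum f ({A \<in> X. horizontal_domino (d A)} \<union> {A \<in> X. vertical_domino (d A)})"
    by simp
  also have "\<dots> = (\<Sum>A | A \<in> X \<and> horizontal_domino (d A). f A) + (\<Sum>A | A \<in> X \<and>
      vertical_domino (d A). f A)"
    by (rule sum.union_disjoint) (use assms(1) nhv in auto)
  finally show ?thesis .
qed

text \<open>Stated for general functions because it is used for the weights themselves in
  \<open>up_op_one\<close> and for their products in \<open>up_op_down_op\<close>.\<close>

lemma domino_balance:
  fixes \<phi> \<psi> :: "cell set \<Rightarrow> 'a::comm_monoid_add"
  assumes S: "young S"
    and h: "\<And>i j. \<phi> (hdom i j) = g i" "\<And>i j. \<psi> (hdom i j) = g (Suc i)"
    and v: "\<And>i j. \<phi> (vdom i j) = g' j" "\<And>i j. \<psi> (vdom i j) = g' (Suc j)"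
  shows "(\<Sum>A\<in>ups S. \<phi> (A - S)) = g 1 + g' 1 + (\<Sum>B\<in>downs S. \<psi> (S - B))"
proof -
  have "(\<Sum>A\<in>ups S. \<phi> (A - S)) = (\<Sum>A | A \<in> ups S \<and> horizontal_domino (A - S). \<phi> (A - S)) +
      (\<Sum>A | A \<in> ups S \<and> vertical_domino (A - S). \<phi> (A - S))"
    by (rule domino_sum_split) (simp_all add: finite_ups[OF S], simp add: ups_def)
  moreover have "(\<Sum>B\<in>downs S. \<psi> (S - B)) = (\<Sum>B | B \<in> downs S \<and>
      horizontal_domino (S - B). \<psi> (S - B)) +
      (\<Sum>B | B \<in> downs S \<and> vertical_domino (S - B). \<psi> (S - B))"
    by (rule domino_sum_split) (simp_all add: finite_downs[OF S], simp add: downs_def)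
  ultimately show ?thesis
    using horizontal_balance[OF S, of \<phi> g \<psi>, OF h] vertical_balance[OF S, of \<phi> g' \<psi>, OF v]
    by (simp add: add_ac)
qed

text \<open>\<open>fix_wt\<close> is both the total up-weight of the unpaired additions in row 1 and
  column 1 and the total weight of a 1-cycle in its two colors. Likewise \<open>cyc_wt\<close> is
  both the commutator of the two operators and the total weight of a 2-cycle, unbarred or with both
  values barred.\<close>

definition fix_wt :: laurent where "fix_wt = mon 1 0 0 + mon 0 1 (1 / 2)"
definition cyc_wt :: laurent where "cyc_wt = 1 + mon 0 0 1"

text \<open>The down-weight in line \<open>r\<close> equals the up-weight in line
  \<open>r + 1\<close>, as \<open>domino_balance\<close> requires; the first row and the first
  column contribute \<open>fix_wt\<close>.\<close>

lemma up_op_one: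
  assumes "young S"
  shows "up_op (\<lambda>_. 1) S = down_op (\<lambda>_. 1) S + fix_wt"
  using domino_balance[OF assms, of up_wt "\<lambda>i. mon (par_sign i) 0 0" down_wt
    "\<lambda>j. mon 0 (par_sign j) (1 / 2)"]
  by (simp add: up_op_def down_op_def fix_wt_def domino_wt par_sign_def add_ac)

text \<open>The product of the two weights depends only on the orientation, so the diagonal sums
  differ exactly by the two unpaired additions, one horizontal and one vertical.\<close>

lemma up_op_down_op:
  assumes "young S"
  shows "up_op (down_op f) S = down_op (up_op f) S + cyc_wt * f S"
proof -
  have "(\<Sum>A\<in>ups S. up_wt (A - S) * down_wt (A - S)) =
      cyc_wt + (\<Sum>C\<in>downs S. down_wt (S - C) * up_wt (S - C))"
    using domino_balance[OF assms, of "\<lambda>d. up_wt d * down_wt d" "\<lambda>_. 1" "\<lambda>d. down_wt d * up_wt d"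
      "\<lambda>_. mon 0 0 1"]
    by (simp add: cyc_wt_def domino_wt mon_mult)
  then show ?thesis using up_op_down_op_commute[OF assms, of f] by simp
qed

subsection \<open>Colored involutions\<close>

text \<open>Arbitrary ground sets allow a cycle to be deleted without renumbering the rest.\<close>

definition colored_invols :: "nat set \<Rightarrow> colored_perm set" where
  "colored_invols A = {(p, B). (\<forall>i. i \<notin> A \<longrightarrow> p i = i) \<and> (\<forall>i. p (p i) = i) \<and> B \<subseteq> A \<and> (\<forall>i\<in>B. p i \<in> B)}"

definition set_wt :: "nat set \<Rightarrow> colored_perm \<Rightarrow> laurent" where
  "set_wt A = (\<lambda>(p, B). mon (int (card {i \<in> A. p i = i \<and> i \<notin> B}))
     (int (card {i \<in> A. p i = i \<and> i \<in> B})) (of_nat (card B) / 2))"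

text \<open>Symmetry at the nonzero entry \<open>(i, p i)\<close> forces \<open>p (p i) = i\<close>,
  and equality of the signs there forces \<open>i\<close> and \<open>p i\<close> to be both barred
  or both unbarred.\<close>

lemma CI_eq: "CI n = colored_invols {1..n}"
proof (intro set_eqI, clarify)
  fix p :: "nat \<Rightarrow> nat" and B :: "nat set"
  let ?A = "{1..n}"
  show "(p, B) \<in> CI n \<longleftrightarrow> (p, B) \<in> colored_invols ?A"
  proof
    assume "(p, B) \<in> CI n"
    then have p: "p permutes ?A" and B: "B \<subseteq> ?A"
      and sym: "\<And>i k. i \<in> ?A \<Longrightarrow> k \<in> ?A \<Longrightarrow> perm_matrix (p, B) i k = perm_matrix (p, B) k i"
      by (auto simp: CI_def colored_perms_def)
    have *: "p (p i) = i \<and> (i \<in> B \<longleftrightarrow> p i \<in> B)" if "i \<in> ?A" for i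
    proof -
      have "p i \<in> ?A" using permutes_in_image[OF p] that by blast
      from sym[OF that this] show ?thesis by (auto split: if_splits)
    qed
    have "p i = i" if "i \<notin> ?A" for i using p that by (simp add: permutes_def)
    then show "(p, B) \<in> colored_invols ?A"
      unfolding colored_invols_def using * B by (auto, metis)
  next
    assume "(p, B) \<in> colored_invols ?A"
    then have p: "\<And>i. i \<notin> ?A \<Longrightarrow> p i = i" "\<And>i. p (p i) = i" and B: "B \<subseteq> ?A" "\<And>i. i \<in> B \<Longrightarrow> p i \<in> B"
      by (auto simp: colored_invols_def)
    have "p permutes ?A" unfolding permutes_def using p by metis
    moreover have "perm_matrix (p, B) i k = perm_matrix (p, B) k i" for i k
      using p(2)[of i] p(2)[of k] B(2)[of i] B(2)[of k] by auto
    ultimately show "(p, B) \<in> CI n" using B(1) by (simp add: CI_def colored_perms_def)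
  qed
qed

lemma wt_eq: "wt n \<pi> = set_wt {1..n} \<pi>"
  by (cases \<pi>) (simp add: wt_def set_wt_def)

lemma finite_colored_invols:
  assumes "finite A"
  shows "finite (colored_invols A)"
proof (rule finite_subset)
  show "colored_invols A \<subseteq> {p. p permutes A} \<times> Pow A"
  proof (rule subrelI)
    fix p B assume "(p, B) \<in> colored_invols A"
    then have "\<And>i. i \<notin> A \<Longrightarrow> p i = i" "\<And>i. p (p i) = i" "B \<subseteq> A"
      by (auto simp: colored_invols_def)
    moreover from this have "p permutes A" unfolding permutes_def by metis
    ultimately show "(p, B) \<in> {p. p permutes A} \<times> Pow A" by blast
  qed
qed (simp add: assms finite_permutations)

lemma card_filter_insert:
  assumes "finite Y" "a \<notin> Y"
  shows "card {i \<in> insert a Y. P i} = card {i \<in> Y. P i} + (if P a then 1 else 0)"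
proof -
  have "{i \<in> insert a Y. P i} = (if P a then insert a {i \<in> Y. P i} else {i \<in> Y. P i})" by auto
  then show ?thesis using assms by simp
qed

text \<open>Deleting the cycle \<open>(a b)\<close>, possibly with \<open>a = b\<close>; the Boolean records whether it is barred.\<close>

lemma sum_invols_cycle:
  assumes X: "finite X" "a \<in> X" "b \<in> X"
  shows "(\<Sum>\<pi> | \<pi> \<in> colored_invols X \<and> fst \<pi> a = b. set_wt X \<pi>) =
    (if a = b then fix_wt else cyc_wt) * (\<Sum>\<pi>\<in>colored_invols (X - {a, b}). set_wt (X - {a, b}) \<pi>)"
proof -
  define Y where "Y = X - {a, b}"
  have Y: "finite Y" "a \<notin> Y" "b \<notin> Y" "X = insert a (insert b Y)"
    using X by (auto simp: Y_def)
  \<comment> \<open>The weight of the deleted cycle, barred if \<open>t\<close> holds; a barred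
    2-cycle has two bars and hence a full power of \<open>q\<close>.\<close>
  define c :: "bool \<Rightarrow> laurent" where
    "c t = (if a = b then (if t then mon 0 1 (1 / 2) else mon 1 0 0) else (if t then mon 0 0 1
        else 1))" for t
  define ext :: "colored_perm \<times> bool \<Rightarrow> colored_perm" where
    "ext = (\<lambda>((p, B), t). (p(a := b, b := a), if t then insert a (insert b B) else B))"
  define res :: "colored_perm \<Rightarrow> colored_perm \<times> bool" where
    "res = (\<lambda>(p, B). ((p(a := a, b := b), B - {a, b}), a \<in> B))"
  have ext_in: "ext (\<pi>, t) \<in> colored_invols X \<and> fst (ext (\<pi>, t)) a = b \<and> res (ext (\<pi>, t)) = (\<pi>, t) \<and>
      set_wt X (ext (\<pi>, t)) = c t * set_wt Y \<pi>" if "\<pi> \<in> colored_invols Y" for \<pi> t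
  proof -
    obtain p B where \<pi>: "\<pi> = (p, B)" by force
    have p: "\<And>i. i \<notin> Y \<Longrightarrow> p i = i" "\<And>i. p (p i) = i" and B: "B \<subseteq> Y" "\<And>i. i \<in> B \<Longrightarrow> p i \<in> B"
      using that unfolding \<pi> colored_invols_def by auto
    have pa: "p a = a" "p b = b" using p(1) Y by auto
    have aB: "a \<notin> B" "b \<notin> B" using B Y by auto
    have ne: "p i \<noteq> a" "p i \<noteq> b" if "i \<noteq> a" "i \<noteq> b" for i
      using that p(2)[of i] pa by auto
    define p' where "p' = p(a := b, b := a)"
    define B' where "B' = (if t then insert a (insert b B) else B)"
    have e: "ext (\<pi>, t) = (p', B')" by (simp add: ext_def \<pi> p'_def B'_def)
    have "(p', B') \<in> colored_invols X"
      unfolding colored_invols_def using p B ne pa aB Y(4)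
      by (auto simp: p'_def B'_def)
    moreover have "p' a = b" by (simp add: p'_def)
    moreover have "res (p', B') = ((p, B), t)"
      using aB pa by (auto simp: res_def p'_def B'_def fun_eq_iff)
    moreover have "set_wt X (p', B') = c t * set_wt Y (p, B)"
    proof -
      have same: "{i \<in> Y. p' i = i \<and> i \<notin> B'} = {i \<in> Y. p i = i \<and> i \<notin> B}"
        "{i \<in> Y. p' i = i \<and> i \<in> B'} = {i \<in> Y. p i = i \<and> i \<in> B}"
        using Y by (auto simp: p'_def B'_def)
      have fB: "finite B" using B(1) Y(1) finite_subset by blast
      show ?thesis
      proof (cases "a = b")
        case True
        have "X = insert a Y" using Y(4) True by simp
        then show ?thesis
          unfolding set_wt_def prod.case c_def \<open>X = insert a Y\<close> card_filter_insert[OF Y(1,2)] same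
          using True aB fB by (auto simp: p'_def B'_def mon_mult add_divide_distrib add.commute)
      next
        case False
        have i: "finite (insert b Y)" "a \<notin> insert b Y" using Y False by auto
        show ?thesis
          unfolding set_wt_def prod.case c_def Y(4) card_filter_insert[OF i] card_filter_insert[OF
            Y(1,3)] same
          using False aB fB by (auto simp: p'_def B'_def mon_mult add_divide_distrib add.commute)
      qed
    qed
    ultimately show ?thesis unfolding e by (simp add: \<pi>)
  qed
  have res_in: "fst (res \<pi>) \<in> colored_invols Y \<and> ext (res \<pi>) = \<pi>"
    if "\<pi> \<in> colored_invols X" "fst \<pi> a = b" for \<pi>
  proof -
    obtain p B where \<pi>: "\<pi> = (p, B)" by force
    have p: "\<And>i. i \<notin> X \<Longrightarrow> p i = i" "\<And>i. p (p i) = i" and B: "B \<subseteq> X" "\<And>i. i \<in> B \<Longrightarrow> p i \<in> B"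
      using that(1) unfolding \<pi> colored_invols_def by auto
    have ab: "p a = b" "p b = a" using that(2) p(2)[of a] by (auto simp: \<pi>)
    have ne: "p i \<noteq> a" "p i \<noteq> b" if "i \<noteq> a" "i \<noteq> b" for i
      using that p(2)[of i] ab by auto
    \<comment> \<open>The bar status of \<open>a\<close>, which \<open>res\<close> records, also
      decides that of \<open>b\<close>.\<close>
    have "a \<in> B \<longleftrightarrow> b \<in> B" using B(2)[of a] B(2)[of b] ab by auto
    then have "ext (res \<pi>) = \<pi>"
      using ab by (auto simp: \<pi> ext_def res_def fun_eq_iff)
    moreover have "fst (res \<pi>) \<in> colored_invols Y"
      unfolding \<pi> res_def prod.case fst_conv colored_invols_def mem_Collect_eq
      using p B ne by (auto simp: Y_def)
    ultimately show ?thesis by simp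
  qed
  have "(\<Sum>\<pi> | \<pi> \<in> colored_invols X \<and> fst \<pi> a = b. set_wt X \<pi>) =
      (\<Sum>(\<pi>, t)\<in>colored_invols Y \<times> UNIV. c t * set_wt Y \<pi>)"
  proof (rule sum.reindex_bij_witness[where i = ext and j = res])
    fix \<pi> assume "\<pi> \<in> {\<pi> \<in> colored_invols X. fst \<pi> a = b}"
    then have r: "fst (res \<pi>) \<in> colored_invols Y" "ext (res \<pi>) = \<pi>" using res_in by auto
    show "ext (res \<pi>) = \<pi>" by (rule r)
    show "res \<pi> \<in> colored_invols Y \<times> UNIV" using r by (simp add: mem_Times_iff)
    show "(case res \<pi> of (\<pi>, t) \<Rightarrow> c t * set_wt Y \<pi>) = set_wt X \<pi>"
      using ext_in[of "fst (res \<pi>)" "snd (res \<pi>)"] r by (simp add: case_prod_beta)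
  next
    fix y assume "y \<in> colored_invols Y \<times> (UNIV :: bool set)"
    then have "fst y \<in> colored_invols Y" by auto
    from ext_in[OF this, of "snd y"] show "res (ext y) =
        y" "ext y \<in> {\<pi> \<in> colored_invols X. fst \<pi> a = b}"
      by auto
  qed
  also have "\<dots> = (\<Sum>\<pi>\<in>colored_invols Y. \<Sum>t\<in>UNIV. c t * set_wt Y \<pi>)"
    by (rule sum.cartesian_product[symmetric])
  also have "\<dots> = (\<Sum>\<pi>\<in>colored_invols Y. (c True + c False) * set_wt Y \<pi>)"
    by (simp add: UNIV_bool distrib_right add.commute)
  also have "c True + c False = (if a = b then fix_wt else cyc_wt)"
    by (simp add: c_def fix_wt_def cyc_wt_def add.commute)
  finally show ?thesis by (simp add: sum_distrib_left Y_def)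
qed

text \<open>The recurrence comes from deleting the cycle of one chosen element. For
  \<open>n = 0\<close> the truncated \<open>n - 1\<close> is harmless, since its coefficient is
  0.\<close>

fun invol_poly :: "nat \<Rightarrow> laurent" where
  "invol_poly 0 = 1"
| "invol_poly (Suc n) = fix_wt * invol_poly n + of_nat n * cyc_wt * invol_poly (n - 1)"

text \<open>For a chosen \<open>a\<close>, the involutions are grouped by the image \<open>b\<close>
  of \<open>a\<close>. The case \<open>b = a\<close> gives the first term of the recurrence, and
  each of the \<open>card X - 1\<close> other values gives the same 2-cycle term.\<close>

lemma sum_colored_invols:
  assumes "finite X"
  shows "(\<Sum>\<pi>\<in>colored_invols X. set_wt X \<pi>) = invol_poly (card X)"
  using assms
proof (induction "card X" arbitrary: X rule: less_induct)
  case less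
  show ?case
  proof (cases "X = {}")
    case True
    have "colored_invols {} = {(\<lambda>i. i, {})}"
      by (auto simp: colored_invols_def)
    then show ?thesis using True by (simp add: set_wt_def)
  next
    case False
    then obtain a where a: "a \<in> X" by blast
    define m where "m = card (X - {a})"
    have cX: "card X = Suc m" using a less.prems
        by (simp add: m_def card_Suc_Diff1 del: card_Diff_singleton card_Diff_insert)
    have img: "(\<lambda>\<pi>. fst \<pi> a) ` colored_invols X \<subseteq> X"
    proof clarsimp
      fix p B assume "(p, B) \<in> colored_invols X"
      then have "\<And>i. i \<notin> X \<Longrightarrow> p i = i" "p (p a) = a" by (auto simp: colored_invols_def)
      then show "p a \<in> X" using a by metis
    qed
    have "(\<Sum>\<pi>\<in>colored_invols X. set_wt X \<pi>) =
        (\<Sum>b\<in>X. \<Sum>\<pi> | \<pi> \<in> colored_invols X \<and> fst \<pi> a = b. set_wt X \<pi>)"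
      by (rule sum.group[symmetric, OF finite_colored_invols[OF less.prems] less.prems img])
    also have "\<dots> = (\<Sum>b\<in>X. (if a = b then fix_wt else cyc_wt) * invol_poly (card (X - {a, b})))"
    proof (rule sum.cong[OF refl])
      fix b assume b: "b \<in> X"
      have "card (X - {a, b}) < card X" using a less.prems by (intro psubset_card_mono) auto
      from less.hyps[OF this] less.prems
      show "(\<Sum>\<pi> | \<pi> \<in> colored_invols X \<and> fst \<pi> a = b. set_wt X \<pi>) =
          (if a = b then fix_wt else cyc_wt) * invol_poly (card (X - {a, b}))"
        unfolding sum_invols_cycle[OF less.prems a b] by simp
    qed
    also have "\<dots> = fix_wt * invol_poly m + (\<Sum>b\<in>X - {a}. cyc_wt * invol_poly (m - 1))"
    proof -
      have "(\<Sum>b\<in>X - {a}. (if a = b then fix_wt else cyc_wt) * invol_poly (card (X - {a, b}))) =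
          (\<Sum>b\<in>X - {a}. cyc_wt * invol_poly (m - 1))"
      proof (rule sum.cong[OF refl])
        fix b assume b: "b \<in> X - {a}"
        have "X - {a, b} = X - {a} - {b}" by auto
        then have "card (X - {a, b}) = m - 1" unfolding m_def using card_Diff_singleton[OF b]
            by simp
        then show "(if a = b then fix_wt else cyc_wt) * invol_poly (card (X - {a, b})) =
            cyc_wt * invol_poly (m - 1)"
          using b by auto
      qed
      then show ?thesis unfolding sum.remove[OF less.prems a] by (simp add: m_def)
    qed
    also have "\<dots> = invol_poly (card X)" by (simp add: cX m_def[symmetric] mult.assoc)
    finally show ?thesis .
  qed
qed

lemma sum_CI: "(\<Sum>\<pi>\<in>CI n. wt n \<pi>) = invol_poly n"
  using sum_colored_invols[of "{1..n}"] by (simp add: CI_eq wt_eq)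

subsection \<open>Removing the last domino of a tableau\<close>

text \<open>Serves both directions of the bijection: stripping the last domino off a tableau and
  putting it back.\<close>

lemma domino_of_glue:
  assumes "S \<subseteq> B" "B \<subseteq> A"
    and lo: "\<And>c. c \<in> B - S \<Longrightarrow> D c \<in> {1..2 * n}"
    and hi: "\<And>c. c \<in> A - B \<Longrightarrow> D c \<in> {2 * n + 1, 2 * n + 2}"
    and D': "\<And>c. c \<in> B - S \<Longrightarrow> D' c = D c"
  shows "domino_of (A - S) D (Suc n) = A - B"
    and "i \<in> {1..n} \<Longrightarrow> domino_of (A - S) D i = domino_of (B - S) D' i"
proof -
  have split: "A - S = (B - S) \<union> (A - B)" using assms(1,2) by auto
  have lo': "D c \<noteq> 2 * n + 1 \<and> D c \<noteq> 2 * n + 2" if "c \<in> B - S" for c using lo[OF that] by auto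
  show "domino_of (A - S) D (Suc n) = A - B"
    unfolding domino_of_def split using lo' hi by auto
  show "domino_of (A - S) D i = domino_of (B - S) D' i" if i: "i \<in> {1..n}"
  proof -
    have "2 * i \<le> 2 * n" using i by simp
    have hi': "D c \<noteq> 2 * i - 1 \<and> D c \<noteq> 2 * i" if "c \<in> A - B" for c
    proof -
      have "2 * n < D c" using hi[OF that] by auto
      then show ?thesis using \<open>2 * i \<le> 2 * n\<close> by linarith
    qed
    show ?thesis unfolding domino_of_def split using hi' D' by auto
  qed
qed

lemma sp_glue:
  assumes "domino_of (A - S) D (Suc n) = A - B"
    and "\<And>i. i \<in> {1..n} \<Longrightarrow> domino_of (A - S) D i = domino_of (B - S) D' i"
  shows "sp (Suc n) (A - S) D = vert_exp (A - B) + sp n (B - S) D'"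
proof -
  let ?V = "{i \<in> {1..n}. vertical_domino (domino_of (B - S) D' i)}"
  have "{i \<in> {1..Suc n}. vertical_domino (domino_of (A - S) D i)} =
      (if vertical_domino (A - B) then insert (Suc n) ?V else ?V)"
    using assms by (auto simp: le_Suc_eq)
  then show ?thesis by (auto simp: sp_def vert_exp_def add_divide_distrib)
qed

text \<open>On a domino of either orientation this is 0 on the first and 1 on the second cell, which
  spares \<open>glue\<close> a case distinction.\<close>

definition cell_rank :: "cell set \<Rightarrow> cell \<Rightarrow> nat" where
  "cell_rank d c = card {c' \<in> d. fst c' + snd c' < fst c + snd c}"

lemma cell_rank_less:
  assumes "finite d" "c \<in> d" "fst c + snd c < fst c' + snd c'"
  shows "cell_rank d c < cell_rank d c'"
  unfolding cell_rank_def by (rule psubset_card_mono) (use assms in auto)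

lemma cell_rank_hdom: "cell_rank (hdom i j) (i, j) = 0" "cell_rank (hdom i j) (i, Suc j) = 1"
proof -
  have "{c' \<in> hdom i j. fst c' + snd c' < fst (i, j) + snd (i, j)} = {}"
    "{c' \<in> hdom i j. fst c' + snd c' < fst (i, Suc j) + snd (i, Suc j)} = {(i, j)}" by auto
  then show "cell_rank (hdom i j) (i, j) = 0" "cell_rank (hdom i j) (i, Suc j) = 1"
    unfolding cell_rank_def by simp_all
qed

lemma cell_rank_vdom: "cell_rank (vdom i j) (i, j) = 0" "cell_rank (vdom i j) (Suc i, j) = 1"
proof -
  have "{c' \<in> vdom i j. fst c' + snd c' < fst (i, j) + snd (i, j)} = {}"
    "{c' \<in> vdom i j. fst c' + snd c' < fst (Suc i, j) + snd (Suc i, j)} = {(i, j)}" by auto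
  then show "cell_rank (vdom i j) (i, j) = 0" "cell_rank (vdom i j) (Suc i, j) = 1"
    unfolding cell_rank_def by simp_all
qed

lemma bij_betw_cell_rank:
  assumes "is_domino d"
  shows "bij_betw (\<lambda>c. m + cell_rank d c) d {m, Suc m}"
  using assms
proof (cases rule: is_domino_cases)
  case (1 i j)
  show ?thesis unfolding 1 bij_betw_def using cell_rank_hdom[of i j] by auto
next
  case (2 i j)
  show ?thesis unfolding 2 bij_betw_def using cell_rank_vdom[of i j] by auto
qed

text \<open>The values on the last domino are forced by monotonicity, so gluing involves no choice;
  \<open>undefined\<close> elsewhere keeps the tableau extensional.\<close>

definition glue :: "nat \<Rightarrow> cell set \<Rightarrow> cell set \<Rightarrow> cell set \<Rightarrow> (cell \<Rightarrow> nat) \<Rightarrow> cell \<Rightarrow> nat" where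
  "glue n A S B D' = (\<lambda>c. if c \<in> B - S then D' c
     else if c \<in> A - B then 2 * n + 1 + cell_rank (A - B) c else undefined)"

text \<open>The diagram left after stripping off the domino with entries \<open>2 * n + 1\<close>
  and \<open>2 * n + 2\<close>; including \<open>S\<close> makes it a Young diagram again.\<close>

definition lower_part :: "nat \<Rightarrow> cell set \<Rightarrow> cell set \<Rightarrow> (cell \<Rightarrow> nat) \<Rightarrow> cell set" where
  "lower_part n A S D = S \<union> {c \<in> A - S. D c \<le> 2 * n}"

text \<open>Entries increase along rows and columns, so the cells with small entries together with
  \<open>S\<close> are closed to the north-west; the two largest entries form a domino by the
  definition of a tableau.\<close>

lemma SDT_lower_part:
  assumes A: "young A" and S: "young S" "S \<subseteq> A" and D: "is_SDT (Suc n) (A - S) D"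
  defines "B \<equiv> lower_part n A S D"
  shows "B \<in> downs A" "S \<subseteq> B" "is_SDT n (B - S) (restrict D (B - S))"
    "sp (Suc n) (A - S) D = vert_exp (A - B) + sp n (B - S) (restrict D (B - S))"
    "glue n A S B (restrict D (B - S)) = D"
proof -
  have ext: "D \<in> extensional (A - S)" and bij: "bij_betw D (A - S) {1..2 * Suc n}"
    and row: "\<And>i j j'. (i, j) \<in> A - S \<Longrightarrow> (i, j') \<in> A - S \<Longrightarrow> j < j' \<Longrightarrow> D (i, j) < D (i, j')"
    and col: "\<And>i i' j. (i, j) \<in> A - S \<Longrightarrow> (i', j) \<in> A - S \<Longrightarrow> i < i' \<Longrightarrow> D (i, j) < D (i', j)"
    and dom: "\<And>i. i \<in> {1..Suc n} \<Longrightarrow> is_domino (domino_of (A - S) D i)"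
    using D unfolding is_SDT_def by blast+
  show SB: "S \<subseteq> B" by (auto simp: B_def lower_part_def)
  have BA: "B \<subseteq> A" using S by (auto simp: B_def lower_part_def)
  have BS: "B - S = {c \<in> A - S. D c \<le> 2 * n}" and AB: "A - B = {c \<in> A - S. \<not> D c \<le> 2 * n}"
    by (auto simp: B_def lower_part_def)
  have rng: "D c \<in> {1..2 * Suc n}" if "c \<in> A - S" for c using bij that by (rule bij_betw_apply)
  have lo: "D c \<in> {1..2 * n}" if "c \<in> B - S" for c using that rng[of c] by (auto simp: BS)
  have hi: "D c \<in> {2 * n + 1, 2 * n + 2}" if "c \<in> A - B" for c using that rng[of c]
      by (auto simp: AB)
  define D' where "D' = restrict D (B - S)"
  have D': "D' c = D c" if "c \<in> B - S" for c using that by (simp add: D'_def)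
  have dg: "domino_of (A - S) D (Suc n) = A - B"
    "\<And>i. i \<in> {1..n} \<Longrightarrow> domino_of (A - S) D i = domino_of (B - S) D' i"
    by (rule domino_of_glue[OF SB BA lo hi D']; assumption)+
  have domAB: "is_domino (A - B)" using dom[of "Suc n"] dg(1) by simp
  have yB: "young B"
  proof (rule youngI)
    show "finite B" using BA young_finite[OF A] finite_subset by blast
    show "1 \<le> i \<and> 1 \<le> j" if "(i, j) \<in> B" for i j using that BA young_pos[OF A] by blast
    fix i j i' j' assume ij: "(i, j) \<in> B" and le: "1 \<le> i'" "i' \<le> i" "1 \<le> j'" "j' \<le> j"
    show "(i', j') \<in> B"
    proof (cases "(i', j') \<in> S")
      case False
      \<comment> \<open>Tableaux increase only along rows and columns, so \<open>(i', j')\<close>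
        and \<open>(i, j)\<close> are compared through the corner \<open>(i', j)\<close>, which must
        first be located in \<open>A - S\<close>.\<close>
      have "(i', j) \<notin> S" "(i, j) \<notin> S" using young_up[OF S(1) False] le by auto
      moreover have "(i', j) \<in> A" "(i', j') \<in> A" "(i, j) \<in> A"
        using young_down[OF A, of i j] ij BA le by auto
      ultimately have in_: "(i', j) \<in> A - S" "(i', j') \<in> A - S" "(i, j) \<in> A - S" using False by auto
      have "D (i', j') \<le> D (i', j)" using row[OF in_(2,1)] le by (cases "j' = j") auto
      also have "\<dots> \<le> D (i, j)" using col[OF in_(1,3)] le by (cases "i' = i") auto
      also have "\<dots> \<le> 2 * n" using ij in_(3) BS by auto
      finally show ?thesis using in_(2) by (simp add: B_def lower_part_def)
    qed (use SB in blast)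
  qed
  show "B \<in> downs A" using yB BA domAB by (simp add: downs_def)
  have bij': "bij_betw D' (B - S) {1..2 * n}"
  proof -
    have "bij_betw D (B - S) {1..2 * n}"
    proof (rule bij_betw_subset[OF bij])
      show "B - S \<subseteq> A - S" using BA by auto
      show "D ` (B - S) = {1..2 * n}"
      proof (intro equalityI subsetI)
        fix x assume x: "x \<in> {1..2 * n}"
        then have "x \<in> D ` (A - S)" using bij_betw_imp_surj_on[OF bij] by auto
        then show "x \<in> D ` (B - S)" using x by (auto simp: BS)
      qed (use lo in auto)
    qed
    then show ?thesis using bij_betw_cong[of "B - S" D' D, OF D'] by simp
  qed
  show "is_SDT n (B - S) (restrict D (B - S))"
    unfolding D'_def[symmetric] is_SDT_def
  proof (intro conjI allI impI ballI)
    show "D' \<in> extensional (B - S)" by (simp add: D'_def)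
    show "bij_betw D' (B - S) {1..2 * n}" by (rule bij')
    show "D' (i, j) < D' (i, j')" if "(i, j) \<in> B - S \<and> (i, j') \<in> B - S \<and> j < j'" for i j j'
      using that D' row[of i j j'] BA by auto
    show "D' (i, j) < D' (i', j)" if "(i, j) \<in> B - S \<and> (i', j) \<in> B - S \<and> i < i'" for i i' j
      using that D' col[of i j i'] BA by auto
    show "is_domino (domino_of (B - S) D' i)" if "i \<in> {1..n}" for i
      using dom[of i] dg(2)[OF that] that by auto
  qed
  show "sp (Suc n) (A - S) D = vert_exp (A - B) + sp n (B - S) (restrict D (B - S))"
    unfolding D'_def[symmetric] by (rule sp_glue[OF dg])
  \<comment> \<open>Only two values remain for the last domino, and monotonicity decides their
    order.\<close>
  have "D c = 2 * n + 1 + cell_rank (A - B) c" if "c \<in> A - B" for c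
    using domAB
  proof (cases rule: is_domino_cases)
    case (1 i j)
    then have m: "(i, j) \<in> A - B" "(i, Suc j) \<in> A - B" by auto
    then have "D (i, j) < D (i, Suc j)" using row[of i j "Suc j"] by (simp add: AB)
    then have "D (i, j) = 2 * n + 1" "D (i, Suc j) = 2 * n + 2" using hi[OF m(1)] hi[OF m(2)]
        by auto
    moreover have "c = (i, j) \<or> c = (i, Suc j)" using that 1 by auto
    ultimately show ?thesis unfolding 1 using cell_rank_hdom[of i j] by auto
  next
    case (2 i j)
    then have m: "(i, j) \<in> A - B" "(Suc i, j) \<in> A - B" by auto
    then have "D (i, j) < D (Suc i, j)" using col[of i j "Suc i"] by (simp add: AB)
    then have "D (i, j) = 2 * n + 1" "D (Suc i, j) = 2 * n + 2" using hi[OF m(1)] hi[OF m(2)]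
        by auto
    moreover have "c = (i, j) \<or> c = (Suc i, j)" using that 2 by auto
    ultimately show ?thesis unfolding 2 using cell_rank_vdom[of i j] by auto
  qed
  then show "glue n A S B (restrict D (B - S)) = D"
    unfolding D'_def[symmetric] glue_def fun_eq_iff using D' ext SB BA
    by (auto simp: extensional_def)
qed

text \<open>The construction inverse to \<open>SDT_lower_part\<close>; the last two conclusions
  recover the data that were glued.\<close>

lemma SDT_glue:
  assumes A: "young A" and S: "young S" and B: "B \<in> downs A" "S \<subseteq> B" and D': "is_SDT n (B - S) D'"
  defines "D \<equiv> glue n A S B D'"
  shows "is_SDT (Suc n) (A - S) D" "lower_part n A S D = B" "restrict D (B - S) = D'"
proof -
  have ext: "D' \<in> extensional (B - S)" and bij: "bij_betw D' (B - S) {1..2 * n}"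
    and row: "\<And>i j j'. (i, j) \<in> B - S \<Longrightarrow> (i, j') \<in> B - S \<Longrightarrow> j < j' \<Longrightarrow> D' (i, j) < D' (i, j')"
    and col: "\<And>i i' j. (i, j) \<in> B - S \<Longrightarrow> (i', j) \<in> B - S \<Longrightarrow> i < i' \<Longrightarrow> D' (i, j) < D' (i', j)"
    and dom: "\<And>i. i \<in> {1..n} \<Longrightarrow> is_domino (domino_of (B - S) D' i)"
    using D' unfolding is_SDT_def by blast+
  have yB: "young B" and BA: "B \<subseteq> A" and domAB: "is_domino (A - B)" using B
      by (auto simp: downs_def)
  have split: "A - S = (B - S) \<union> (A - B)" using B(2) BA by auto
  have D_lo: "D c = D' c" if "c \<in> B - S" for c using that by (simp add: D_def glue_def)
  have D_hi: "D c = (2 * n + 1) + cell_rank (A - B) c" if "c \<in> A - B" for c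
    using that by (simp add: D_def glue_def)
  have bij_hi: "bij_betw D (A - B) {2 * n + 1, Suc (2 * n + 1)}"
    using bij_betw_cell_rank[OF domAB, of "2 * n + 1"] bij_betw_cong[of "A - B" D, OF D_hi] by blast
  have bij_lo: "bij_betw D (B - S) {1..2 * n}" using bij bij_betw_cong[of "B - S" D, OF D_lo]
      by blast
  have lo: "D c \<in> {1..2 * n}" if "c \<in> B - S" for c using bij_lo that by (rule bij_betw_apply)
  have hi: "D c \<in> {2 * n + 1, 2 * n + 2}" if "c \<in> A - B" for c
    using bij_betw_apply[OF bij_hi that] by simp
  have dg: "domino_of (A - S) D (Suc n) = A - B"
    "\<And>i. i \<in> {1..n} \<Longrightarrow> domino_of (A - S) D i = domino_of (B - S) D' i"
    by (rule domino_of_glue[OF B(2) BA lo hi D_lo[symmetric]]; assumption)+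
  have fin: "finite (A - B)" using young_finite[OF A] by simp
  \<comment> \<open>Rows and columns are treated together. A step from the last domino back into
    \<open>B\<close> is impossible because \<open>B\<close> is a diagram. Inside \<open>B\<close>
    the comparison is the assumption \<open>low\<close>, as \<open>D'\<close> is known to increase
    only along a common row or column.\<close>
  have less: "D (i, j) < D (i', j')"
    if c: "(i, j) \<in> A - S" "(i', j') \<in> A - S" and le: "i \<le> i'" "j \<le> j'" "(i, j) \<noteq> (i', j')"
      and low: "(i, j) \<in> B - S \<Longrightarrow> (i', j') \<in> B - S \<Longrightarrow> D' (i, j) < D' (i', j')" for i j i' j'
  proof (cases "(i', j') \<in> B")
    case True
    then have "(i, j) \<in> B" using young_down[OF yB True, of i j] young_pos[OF A, of i j] c le by auto
    then show ?thesis using low True c D_lo by auto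
  next
    case False
    then have c': "(i', j') \<in> A - B" using c by auto
    show ?thesis
    proof (cases "(i, j) \<in> B")
      case True
      then show ?thesis using lo[of "(i, j)"] hi[OF c'] c by auto
    next
      case False
      then have "(i, j) \<in> A - B" using c by auto
      moreover have "i + j < i' + j'" using le by auto
      ultimately show ?thesis
        using cell_rank_less[OF fin, of "(i, j)" "(i', j')"] D_hi c' by simp
    qed
  qed
  show "is_SDT (Suc n) (A - S) D"
    unfolding is_SDT_def
  proof (intro conjI allI impI ballI)
    show "D \<in> extensional (A - S)" using split by (auto simp: extensional_def D_def glue_def)
    have "bij_betw D ((B - S) \<union> (A - B)) ({1..2 * n} \<union> {2 * n + 1, Suc (2 * n + 1)})"
      by (rule bij_betw_combine[OF bij_lo bij_hi]) auto
    moreover have "{1..2 * n} \<union> {2 * n + 1, Suc (2 * n + 1)} = {1..2 * Suc n}" by auto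
    ultimately show "bij_betw D (A - S) {1..2 * Suc n}" using split by metis
    show "D (i, j) < D (i, j')" if "(i, j) \<in> A - S \<and> (i, j') \<in> A - S \<and> j < j'" for i j j'
      using that row by (intro less) auto
    show "D (i, j) < D (i', j)" if "(i, j) \<in> A - S \<and> (i', j) \<in> A - S \<and> i < i'" for i i' j
      using that col by (intro less) auto
    show "is_domino (domino_of (A - S) D i)" if "i \<in> {1..Suc n}" for i
    proof (cases "i = Suc n")
      case True
      then show ?thesis using dg(1) domAB by simp
    next
      case False
      then have "i \<in> {1..n}" using that by auto
      then show ?thesis using dg(2) dom by simp
    qed
  qed
  have "D c \<le> 2 * n" if "c \<in> B - S" for c using lo[OF that] by simp
  moreover have "\<not> D c \<le> 2 * n" if "c \<in> A - B" for c using hi[OF that] by auto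
  ultimately show "lower_part n A S D = B"
    unfolding lower_part_def using B(2) BA by blast
  show "restrict D (B - S) = D'"
    using D_lo ext by (auto simp: fun_eq_iff restrict_def extensional_def)
qed

text \<open>A tableau corresponds to the position of the domino with its two largest entries and a
  smaller tableau; that domino adds \<open>vert_exp\<close> to \<open>sp\<close>.\<close>

lemma f2_Suc:
  assumes A: "young A" and S: "young S" "S \<subseteq> A"
  shows "f2 (Suc n) (A - S) =
    (\<Sum>B | B \<in> downs A \<and> S \<subseteq> B. mon 0 0 (vert_exp (A - B)) * f2 n (B - S))"
proof -
  let ?X = "{B. B \<in> downs A \<and> S \<subseteq> B}"
  have finX: "finite ?X" using finite_downs[OF A] by simp
  have finD: "finite {D. is_SDT n (B - S) D}" if "B \<in> ?X" for B
    using that downs_young young_finite by (intro finite_SDT) blast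
  have "(\<Sum>B\<in>?X. mon 0 0 (vert_exp (A - B)) * f2 n (B - S)) =
      (\<Sum>B\<in>?X. \<Sum>D' | is_SDT n (B - S) D'. mon 0 0 (vert_exp (A - B) + sp n (B - S) D'))"
    by (simp add: f2_def sum_distrib_left mon_mult)
  also have "\<dots> = (\<Sum>(B, D')\<in>(SIGMA B:?X. {D'. is_SDT n (B - S) D'}). mon 0 0 (vert_exp (A - B) +
      sp n (B - S) D'))"
    by (rule sum.Sigma) (use finX finD in auto)
  also have "\<dots> = (\<Sum>D | is_SDT (Suc n) (A - S) D. mon 0 0 (sp (Suc n) (A - S) D))"
  proof (rule sum.reindex_bij_witness[symmetric,
      where i = "\<lambda>(B, D'). glue n A S B D'" and j = "\<lambda>D. (lower_part n A S D, restrict D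
          (lower_part n A S D - S))"])
    fix D assume "D \<in> {D. is_SDT (Suc n) (A - S) D}"
    then have D: "is_SDT (Suc n) (A - S) D" by simp
    note l = SDT_lower_part[OF A S D]
    show "(case (lower_part n A S D, restrict D (lower_part n A S D - S)) of (B, D') \<Rightarrow> glue n A S
        B D') = D"
      using l(5) by simp
    show "(lower_part n A S D, restrict D (lower_part n A S D - S)) \<in> (SIGMA B:?X. {D'. is_SDT n
        (B - S) D'})"
      using l(1-3) by simp
    show "(case (lower_part n A S D, restrict D (lower_part n A S D - S)) of
        (B, D') \<Rightarrow> mon 0 0 (vert_exp (A - B) + sp n (B - S) D')) = mon 0 0 (sp (Suc n) (A - S) D)"
      using l(4) by simp
  next
    fix y assume "y \<in> (SIGMA B:?X. {D'. is_SDT n (B - S) D'})"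
    then obtain B D' where y: "y = (B, D')" "B \<in> downs A" "S \<subseteq> B" "is_SDT n (B - S) D'" by auto
    note g = SDT_glue[OF A S(1) y(2-4)]
    show "(lower_part n A S (case y of (B, D') \<Rightarrow> glue n A S B D'),
        restrict (case y of (B, D') \<Rightarrow> glue n A S B D') (lower_part n A S (case y of (B, D') \<Rightarrow> glue
            n A S B D') - S)) = y"
      using g by (simp add: y(1))
    show "(case y of (B, D') \<Rightarrow> glue n A S B D') \<in> {D. is_SDT (Suc n) (A - S) D}"
      using g by (simp add: y(1))
  qed
  finally show ?thesis by (simp add: f2_def)
qed

text \<open>By extensionality the only tableau is the everywhere undefined function.\<close>

lemma f2_0_empty: "f2 0 {} = 1"
proof -
  have "{D. is_SDT 0 {} D} = {\<lambda>_. undefined}"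
    by (auto simp: is_SDT_def bij_betw_def)
  then show ?thesis by (simp add: f2_def sp_def)
qed

subsection \<open>The operator identity\<close>

lemma down_op_cong: "(\<And>B. young B \<Longrightarrow> f B = g B) \<Longrightarrow> down_op f S = down_op g S"
  unfolding down_op_def by (rule sum.cong) (auto dest: downs_young)

lemma up_op_cong: "(\<And>A. young A \<Longrightarrow> f A = g A) \<Longrightarrow> up_op f S = up_op g S"
  unfolding up_op_def by (rule sum.cong) (auto dest: ups_young)

lemma down_op_linear: "down_op (\<lambda>B. f B + k * g B) S = down_op f S + k * down_op g S"
  unfolding down_op_def by (simp add: distrib_left sum.distrib sum_distrib_left mult.left_commute)

lemma up_op_sum: "up_op (\<lambda>A. \<Sum>j\<in>J. a j * E j A) S = (\<Sum>j\<in>J. a j * up_op (E j) S)"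
  unfolding up_op_def by (simp add: sum_distrib_left mult.left_commute) (rule sum.swap)

lemma down_op_funpow_linear: "(down_op ^^ j) (\<lambda>B. f B + k * g B) = (\<lambda>S. (down_op ^^ j) f S +
    k * (down_op ^^ j) g S)"
  by (induction j) (simp_all add: down_op_linear)

lemma down_op_funpow_cong:
  assumes "\<And>B. young B \<Longrightarrow> f B = g B" "young S"
  shows "(down_op ^^ j) f S = (down_op ^^ j) g S"
  using assms(2)
proof (induction j arbitrary: S)
  case (Suc j)
  then show ?case by (auto intro: down_op_cong)
qed (simp add: assms(1))

text \<open>The commutator is the scalar \<open>cyc_wt\<close>, so moving \<open>up_op\<close> past
  each of the \<open>j\<close> copies of \<open>down_op\<close> yields this scalar once, at the cost
  of one copy.\<close>

lemma up_op_down_op_funpow: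
  assumes "young S"
  shows "up_op ((down_op ^^ j) f) S = (down_op ^^ j) (up_op f) S +
      of_nat j * cyc_wt * (down_op ^^ (j - 1)) f S"
  using assms
proof (induction j arbitrary: S)
  case (Suc j)
  have "up_op ((down_op ^^ Suc j) f) S = down_op (up_op ((down_op ^^ j) f)) S +
      cyc_wt * (down_op ^^ j) f S"
    using up_op_down_op[OF Suc.prems, of "(down_op ^^ j) f"] by simp
  also have "down_op (up_op ((down_op ^^ j) f)) S =
      down_op (\<lambda>B. (down_op ^^ j) (up_op f) B + (of_nat j * cyc_wt) * (down_op ^^ (j - 1)) f B) S"
    by (rule down_op_cong) (rule Suc.IH)
  also have "\<dots> = (down_op ^^ Suc j) (up_op f) S + of_nat j * cyc_wt * down_op ((down_op ^^ (j -
      1)) f) S"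
    by (simp add: down_op_linear)
  \<comment> \<open>For \<open>j = 0\<close> the truncated \<open>j - 1\<close> does not matter,
    both sides being 0.\<close>
  also have "of_nat j * cyc_wt * down_op ((down_op ^^ (j - 1)) f) S =
      of_nat j * cyc_wt * (down_op ^^ j) f S"
    by (cases j) simp_all
  finally show ?case by (simp add: algebra_simps)
qed simp

lemma up_op_down_op_funpow_one:
  assumes "young S"
  shows "up_op ((down_op ^^ j) (\<lambda>_. 1)) S = (down_op ^^ Suc j) (\<lambda>_. 1) S +
      fix_wt * (down_op ^^ j) (\<lambda>_. 1) S
    + of_nat j * cyc_wt * (down_op ^^ (j - 1)) (\<lambda>_. 1) S"
proof -
  have "(down_op ^^ j) (up_op (\<lambda>_. 1)) S = (down_op ^^ j) (\<lambda>B. down_op (\<lambda>_. 1) B + fix_wt * 1) S"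
    by (rule down_op_funpow_cong[OF _ assms]) (simp add: up_op_one)
  also have "\<dots> = (down_op ^^ j) (down_op (\<lambda>_. 1)) S + fix_wt * (down_op ^^ j) (\<lambda>_. 1) S"
    by (simp only: down_op_funpow_linear)
  also have "(down_op ^^ j) (down_op (\<lambda>_. 1)) = (down_op ^^ Suc j) (\<lambda>_. 1)"
      by (simp only: funpow_Suc_right o_apply)
  finally show ?thesis using up_op_down_op_funpow[OF assms, of j "\<lambda>_. 1"] by simp
qed

text \<open>Here \<open>e j\<close> stands for the \<open>j\<close>-th power of
  \<open>down_op\<close> applied to 1. Pascal's rule handles the raised index; the recurrence of
  \<open>invol_poly\<close> and the absorption identity for binomials handle the other two
  terms.\<close>

lemma invol_poly_convolution_step:
  "(\<Sum>j\<le>n. of_nat (n choose j) * invol_poly (n - j) * (e (Suc j) + fix_wt * e j +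
      of_nat j * cyc_wt * e (j - 1))) =
    (\<Sum>j\<le>Suc n. of_nat (Suc n choose j) * invol_poly (Suc n - j) * e j)" (is "?L = ?R")
proof -
  let ?C = "\<lambda>j. of_nat (n choose j) :: laurent"
  have shift: "(\<Sum>j\<le>n. ?C j * of_nat j * invol_poly (n - j) * e (j - 1)) =
      (\<Sum>j\<le>n. ?C j * of_nat (n - j) * invol_poly (n - j - 1) * e j)"
  proof (cases n)
    case (Suc m)
    \<comment> \<open>After the index of \<open>e\<close> is shifted, absorption turns the factor
      \<open>j\<close> into \<open>n - j\<close>, the coefficient produced by the recurrence for
      \<open>invol_poly (Suc (n - j))\<close>.\<close>
    have abs: "?C (Suc j) * of_nat (Suc j) = ?C j * of_nat (n - j)" for j
    proof -
      have "(n choose Suc j) * Suc j = (n choose j) * (n - j)"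
        using binomial_absorb_comp[of n j] binomial_absorption[of j n] by (simp add: mult.commute)
      then show ?thesis by (metis of_nat_mult)
    qed
    have "(\<Sum>j\<le>n. ?C j * of_nat j * invol_poly (n - j) * e (j - 1)) =
        (\<Sum>j\<le>m. ?C (Suc j) * of_nat (Suc j) * invol_poly (n - Suc j) * e j)"
      unfolding Suc by (subst sum.atMost_Suc_shift) simp
    also have "\<dots> = (\<Sum>j\<le>m. ?C j * of_nat (n - j) * invol_poly (n - j - 1) * e j)"
      unfolding abs by simp
    also have "\<dots> = (\<Sum>j\<le>n. ?C j * of_nat (n - j) * invol_poly (n - j - 1) * e j)"
      unfolding Suc by simp
    finally show ?thesis .
  qed simp
  have "?R = invol_poly (Suc n) * e 0 + (\<Sum>j\<le>n. of_nat (Suc n choose Suc j) * invol_poly (n - j) *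
      e (Suc j))"
    by (subst sum.atMost_Suc_shift) simp
  also have "(\<Sum>j\<le>n. of_nat (Suc n choose Suc j) * invol_poly (n - j) * e (Suc j)) =
      (\<Sum>j\<le>n. ?C j * invol_poly (n - j) * e (Suc j)) +
          (\<Sum>j\<le>n. ?C (Suc j) * invol_poly (n - j) * e (Suc j))"
    by (simp add: sum.distrib algebra_simps)
  also have "invol_poly (Suc n) * e 0 + ((\<Sum>j\<le>n. ?C j * invol_poly (n - j) * e (Suc j)) +
        (\<Sum>j\<le>n. ?C (Suc j) * invol_poly (n - j) * e (Suc j))) =
      (\<Sum>j\<le>n. ?C j * invol_poly (n - j) * e (Suc j)) +
          (\<Sum>j\<le>Suc n. ?C j * invol_poly (Suc n - j) * e j)"
    unfolding sum.atMost_Suc_shift by (simp add: add_ac del: invol_poly.simps(2))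
  \<comment> \<open>The top term vanishes because \<open>n choose Suc n\<close> is 0; in the others
    the index is a successor, so the recurrence applies.\<close>
  also have "(\<Sum>j\<le>Suc n. ?C j * invol_poly (Suc n - j) * e j) =
      (\<Sum>j\<le>n. ?C j * invol_poly (Suc (n - j)) * e j)"
    by (simp add: Suc_diff_le binomial_eq_0)
  also have "\<dots> = (\<Sum>j\<le>n. ?C j * invol_poly (n - j) * (fix_wt * e j)) +
      cyc_wt * (\<Sum>j\<le>n. ?C j * of_nat (n - j) * invol_poly (n - j - 1) * e j)"
    by (simp add: sum.distrib sum_distrib_left distrib_left distrib_right mult_ac)
  also have "cyc_wt * (\<Sum>j\<le>n. ?C j * of_nat (n - j) * invol_poly (n - j - 1) * e j) =
      (\<Sum>j\<le>n. ?C j * invol_poly (n - j) * (of_nat j * cyc_wt * e (j - 1)))"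
    unfolding shift[symmetric] by (simp add: sum_distrib_left mult_ac)
  finally show ?thesis by (simp add: sum.distrib distrib_left add.assoc)
qed

lemma up_op_funpow_one:
  assumes "young S"
  shows "(up_op ^^ n) (\<lambda>_. 1) S = (\<Sum>j\<le>n. of_nat (n choose j) * invol_poly (n - j) * (down_op ^^ j)
      (\<lambda>_. 1) S)"
  using assms
proof (induction n arbitrary: S)
  case (Suc n)
  have "(up_op ^^ Suc n) (\<lambda>_. 1) S =
      up_op (\<lambda>A. \<Sum>j\<le>n. of_nat (n choose j) * invol_poly (n - j) * (down_op ^^ j) (\<lambda>_. 1) A) S"
    unfolding funpow.simps o_apply by (rule up_op_cong) (rule Suc.IH)
  also have "\<dots> = (\<Sum>j\<le>n. of_nat (n choose j) * invol_poly (n - j) * up_op ((down_op ^^ j) (\<lambda>_. 1))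
      S)"
    by (rule up_op_sum)
  also have "\<dots> = (\<Sum>j\<le>Suc n. of_nat (Suc n choose j) * invol_poly (Suc n - j) * (down_op ^^ j) (\<lambda>_.
      1) S)"
    unfolding up_op_down_op_funpow_one[OF Suc.prems] by (rule invol_poly_convolution_step)
  finally show ?case .
qed simp

section \<open>The sums W as iterated operators\<close>

lemma even_cells_glue:
  assumes "finite A" "S \<subseteq> B" "B \<subseteq> A"
  shows "even_row_cells (A - S) = even_row_cells (A - B) + even_row_cells (B - S)"
    "even_col_cells (A - S) = even_col_cells (A - B) + even_col_cells (B - S)"
proof -
  have fin: "finite {(i, j) \<in> X. P i j}" if "X \<subseteq> A" for X P
    using assms(1) that by (auto intro: finite_subset)
  have "{(i, j) \<in> A - S. P i j} = {(i, j) \<in> A - B. P i j} \<union> {(i, j) \<in> B - S. P i j}" for P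
    using assms by auto
  then have "card {(i, j) \<in> A - S. P i j} = card {(i, j) \<in> A - B. P i j} +
      card {(i, j) \<in> B - S. P i j}" for P
    using card_Un_disjoint[of "{(i, j) \<in> A - B. P i j}" "{(i, j) \<in> B - S. P i j}"] fin[of "A - B"
      P] fin[of "B - S" P] assms(3)
    by fastforce
  from this[of "\<lambda>i j. even i"] this[of "\<lambda>i j. even j"]
  show "even_row_cells (A - S) = even_row_cells (A - B) + even_row_cells (B - S)"
    "even_col_cells (A - S) = even_col_cells (A - B) + even_col_cells (B - S)"
    unfolding even_row_cells_def even_col_cells_def .
qed

definition up_mon :: "nat \<Rightarrow> cell set \<Rightarrow> laurent" where
  "up_mon n d = mon (int n - int (even_row_cells d)) (int n - int (even_col_cells d)) 0"

definition down_mon :: "nat \<Rightarrow> cell set \<Rightarrow> laurent" where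
  "down_mon n d = mon (- int n + int (even_row_cells d)) (- int n + int (even_col_cells d)) 0"

text \<open>The term \<open>int (Suc n)\<close> in each exponent splits into 1 for the domino and
  \<open>n\<close> for the rest; the power of \<open>q\<close> that \<open>f2_Suc\<close> splits off
  completes the weight of the domino.\<close>

lemma up_mon_glue:
  assumes "finite A" "S \<subseteq> B" "B \<subseteq> A"
  shows "up_mon (Suc n) (A - S) * mon 0 0 (vert_exp (A - B)) = up_mon n (B - S) * up_wt (A - B)"
  by (simp add: up_mon_def up_wt_def mon_mult even_cells_glue[OF assms] algebra_simps)

lemma down_mon_glue:
  assumes "finite A" "S \<subseteq> B" "B \<subseteq> A"
  shows "down_mon (Suc n) (A - S) * mon 0 0 (vert_exp (A - B)) =
      down_wt (A - B) * down_mon n (B - S)"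
  by (simp add: down_mon_def down_wt_def mon_mult even_cells_glue[OF assms] algebra_simps)

lemma card_glue:
  assumes "finite A" "S \<subseteq> B" "B \<subseteq> A" "is_domino (A - B)"
  shows "card (A - S) = 2 + card (B - S)"
proof -
  have "A - S = (A - B) \<union> (B - S)" using assms by auto
  moreover have "card ((A - B) \<union> (B - S)) = card (A - B) + card (B - S)"
    using assms by (intro card_Un_disjoint) (auto intro: finite_subset)
  ultimately show ?thesis using card_domino[OF assms(4)] by simp
qed

abbreviation young_above :: "nat \<Rightarrow> cell set \<Rightarrow> cell set set" where
  "young_above n S \<equiv> {A. young A \<and> S \<subseteq> A \<and> card (A - S) = 2 * n}"

abbreviation young_below :: "nat \<Rightarrow> cell set \<Rightarrow> cell set set" where
  "young_below n S \<equiv> {B. young B \<and> B \<subseteq> S \<and> card (S - B) = 2 * n}"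

lemma finite_young_below: "young S \<Longrightarrow> finite (young_below n S)"
  by (rule finite_subset[of _ "Pow S"]) (auto simp: young_finite)

text \<open>The test function \<open>g\<close> makes the induction work: \<open>f2_Suc\<close>
  strips the outermost domino, which lies at the varying diagram \<open>A\<close> and not at
  \<open>S\<close>, so one \<open>up_op\<close> is absorbed into \<open>g\<close>.\<close>

lemma sum_above_eq:
  assumes S: "young S"
  shows "(\<Sum>A\<in>young_above n S. up_mon n (A - S) * f2 n (A - S) * g A) = (up_op ^^ n) g S"
proof (induction n arbitrary: g)
  case 0
  have "young_above 0 S = {S}"
    using S by (auto simp: young_finite)
  then show ?case by (simp add: f2_0_empty up_mon_def even_row_cells_def even_col_cells_def)
next
  case (Suc n)
  let ?P = "\<lambda>A. {B. B \<in> downs A \<and> S \<subseteq> B}"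
  have "(\<Sum>A\<in>young_above (Suc n) S. up_mon (Suc n) (A - S) * f2 (Suc n) (A - S) * g A) =
      (\<Sum>A\<in>young_above (Suc n) S. \<Sum>B\<in>?P A. up_mon n (B - S) * f2 n (B - S) * (up_wt (A - B) * g A))"
  proof (rule sum.cong[OF refl])
    fix A assume "A \<in> young_above (Suc n) S"
    then have A: "young A" "S \<subseteq> A" by auto
    have "up_mon (Suc n) (A - S) * f2 (Suc n) (A - S) * g A =
        (\<Sum>B\<in>?P A. (up_mon (Suc n) (A - S) * mon 0 0 (vert_exp (A - B))) * f2 n (B - S) * g A)"
      unfolding f2_Suc[OF A(1) S A(2)] by (simp add: sum_distrib_left sum_distrib_right mult.assoc)
    also have "\<dots> = (\<Sum>B\<in>?P A. up_mon n (B - S) * f2 n (B - S) * (up_wt (A - B) * g A))"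
    proof (rule sum.cong[OF refl])
      fix B assume "B \<in> ?P A"
      then have "S \<subseteq> B" "B \<subseteq> A" by (auto simp: downs_def)
      from up_mon_glue[OF young_finite[OF A(1)] this, of n]
      show "up_mon (Suc n) (A - S) * mon 0 0 (vert_exp (A - B)) * f2 n (B - S) * g A =
          up_mon n (B - S) * f2 n (B - S) * (up_wt (A - B) * g A)"
        by (simp add: mult_ac)
    qed
    finally show "up_mon (Suc n) (A - S) * f2 (Suc n) (A - S) * g A =
      (\<Sum>B\<in>?P A. up_mon n (B - S) * f2 n (B - S) * (up_wt (A - B) * g A))" .
  qed
  also have "\<dots> = (\<Sum>(A, B)\<in>Sigma (young_above (Suc n) S) ?P. up_mon n (B - S) * f2 n (B - S) *
      (up_wt (A - B) * g A))"
    by (rule sum.Sigma) (use finite_young_above[OF S] finite_downs in auto)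
  \<comment> \<open>The pairs are reorganised by the smaller diagram \<open>B\<close>;
    \<open>card_glue\<close> matches the size conditions.\<close>
  also have "\<dots> = (\<Sum>(B, A)\<in>Sigma (young_above n S) ups. up_mon n (B - S) * f2 n (B - S) * (up_wt (A
      - B) * g A))"
  proof (rule sum.reindex_bij_witness[where i = prod.swap and j = prod.swap])
    fix y assume "y \<in> Sigma (young_above n S) ups"
    then obtain B A where y: "y = (B, A)" "young B" "S \<subseteq> B" "card (B - S) = 2 * n" "A \<in> ups B"
        by auto
    then have A: "young A" "B \<subseteq> A" "is_domino (A - B)" by (auto simp: ups_def)
    show "prod.swap y \<in> Sigma (young_above (Suc n) S) ?P"
      using y A card_glue[OF young_finite[OF A(1)] y(3) A(2,3)] ups_iff_downs by auto
  next
    fix y assume "y \<in> Sigma (young_above (Suc n) S) ?P"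
    then obtain B A where y: "y = (A, B)" "young A" "S \<subseteq> B" "card (A - S) =
        2 * Suc n" "B \<in> downs A" by auto
    then have B: "young B" "B \<subseteq> A" "is_domino (A - B)" by (auto simp: downs_def)
    show "prod.swap y \<in> Sigma (young_above n S) ups"
      using y B card_glue[OF young_finite[OF y(2)] y(3) B(2,3)] ups_iff_downs by auto
  qed auto
  also have "\<dots> = (\<Sum>B\<in>young_above n S. \<Sum>A\<in>ups B. up_mon n (B - S) * f2 n (B - S) * (up_wt (A - B) *
      g A))"
    by (rule sum.Sigma[symmetric]) (use finite_young_above[OF S] finite_ups in auto)
  also have "\<dots> = (\<Sum>B\<in>young_above n S. up_mon n (B - S) * f2 n (B - S) * up_op g B)"
    by (simp add: up_op_def sum_distrib_left)
  also have "\<dots> = (up_op ^^ Suc n) g S" unfolding Suc.IH by (simp add: funpow_swap1)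
  finally show ?case .
qed

text \<open>Here the outermost domino is removed from \<open>S\<close> itself, so the induction
  varies \<open>S\<close> and needs no test function.\<close>

lemma sum_below_eq:
  assumes "young S"
  shows "(\<Sum>B\<in>young_below n S. down_mon n (S - B) * f2 n (S - B)) = (down_op ^^ n) (\<lambda>_. 1) S"
  using assms
proof (induction n arbitrary: S)
  case 0
  have "young_below 0 S = {S}"
    using 0 by (auto simp: young_finite)
  then show ?case by (simp add: f2_0_empty down_mon_def even_row_cells_def even_col_cells_def)
next
  case (Suc n)
  note S = Suc.prems
  let ?P = "\<lambda>B. {C. C \<in> downs S \<and> B \<subseteq> C}"
  have "(\<Sum>B\<in>young_below (Suc n) S. down_mon (Suc n) (S - B) * f2 (Suc n) (S - B)) =
      (\<Sum>B\<in>young_below (Suc n) S. \<Sum>C\<in>?P B. down_wt (S - C) * (down_mon n (C - B) * f2 n (C - B)))"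
  proof (rule sum.cong[OF refl])
    fix B assume "B \<in> young_below (Suc n) S"
    then have B: "young B" "B \<subseteq> S" by auto
    have "down_mon (Suc n) (S - B) * f2 (Suc n) (S - B) =
        (\<Sum>C\<in>?P B. (down_mon (Suc n) (S - B) * mon 0 0 (vert_exp (S - C))) * f2 n (C - B))"
      unfolding f2_Suc[OF S B] by (simp add: sum_distrib_left mult.assoc)
    also have "\<dots> = (\<Sum>C\<in>?P B. down_wt (S - C) * (down_mon n (C - B) * f2 n (C - B)))"
    proof (rule sum.cong[OF refl])
      fix C assume "C \<in> ?P B"
      then have "B \<subseteq> C" "C \<subseteq> S" by (auto simp: downs_def)
      from down_mon_glue[OF young_finite[OF S] this, of n]
      show "down_mon (Suc n) (S - B) * mon 0 0 (vert_exp (S - C)) * f2 n (C - B) =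
          down_wt (S - C) * (down_mon n (C - B) * f2 n (C - B))"
        by (simp add: mult_ac)
    qed
    finally show "down_mon (Suc n) (S - B) * f2 (Suc n) (S - B) =
      (\<Sum>C\<in>?P B. down_wt (S - C) * (down_mon n (C - B) * f2 n (C - B)))" .
  qed
  also have "\<dots> = (\<Sum>(B, C)\<in>Sigma (young_below (Suc n) S) ?P. down_wt (S - C) * (down_mon n (C - B)
      * f2 n (C - B)))"
    by (rule sum.Sigma) (simp_all only: finite_young_below[OF S], use finite_downs[OF S] in auto)
  also have "\<dots> = (\<Sum>(C, B)\<in>Sigma (downs S) (young_below n). down_wt (S - C) * (down_mon n (C - B) *
      f2 n (C - B)))"
  proof (rule sum.reindex_bij_witness[where i = prod.swap and j = prod.swap])
    fix y assume "y \<in> Sigma (downs S) (young_below n)"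
    then obtain B C where y: "y = (C, B)" "young B" "B \<subseteq> C" "card (C - B) = 2 * n" "C \<in> downs S"
        by auto
    then have C: "young C" "C \<subseteq> S" "is_domino (S - C)" by (auto simp: downs_def)
    show "prod.swap y \<in> Sigma (young_below (Suc n) S) ?P"
      using y C card_glue[OF young_finite[OF S] y(3) C(2,3)] by auto
  next
    fix y assume "y \<in> Sigma (young_below (Suc n) S) ?P"
    then obtain B C where y: "y = (B, C)" "young B" "B \<subseteq> C" "card (S - B) =
        2 * Suc n" "C \<in> downs S" by auto
    then have C: "young C" "C \<subseteq> S" "is_domino (S - C)" by (auto simp: downs_def)
    show "prod.swap y \<in> Sigma (downs S) (young_below n)"
      using y C card_glue[OF young_finite[OF S] y(3) C(2,3)] by auto
  qed auto
  also have "\<dots> = (\<Sum>C\<in>downs S. \<Sum>B\<in>young_below n C. down_wt (S - C) * (down_mon n (C - B) * f2 n (C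
      - B)))"
    by (rule sum.Sigma[symmetric]) (use finite_downs[OF S] finite_young_below downs_young in auto)
  also have "\<dots> = (\<Sum>C\<in>downs S. down_wt (S - C) * (\<Sum>B\<in>young_below n C. down_mon n (C - B) * f2 n (C
      - B)))"
    by (simp add: sum_distrib_left)
  also have "\<dots> = down_op ((down_op ^^ n) (\<lambda>_. 1)) S"
    unfolding down_op_def by (rule sum.cong[OF refl]) (simp add: Suc.IH downs_young
      down_op_def[symmetric])
  finally show ?case by simp
qed

lemma W_pos_eq:
  assumes "is_partition a"
  shows "W_pos a n = (up_op ^^ n) (\<lambda>_. 1) (cells a)"
proof -
  \<comment> \<open>The factor \<open>1\<close> is the test function of
    \<open>sum_above_eq\<close>.\<close>
  have "W_pos a n = (\<Sum>l | is_partition l \<and> skew_size l a (2 * n).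
      up_mon n (cells l - cells a) * f2 n (cells l - cells a) * 1)"
    by (simp add: W_pos_def up_mon_def skew_def)
  also have "\<dots> = (\<Sum>A\<in>young_above n (cells a). up_mon n (A - cells a) * f2 n (A - cells a) * 1)"
    using bij_betw_cells[of "\<lambda>A. cells a \<subseteq> A \<and> card (A - cells a) = 2 * n"]
    by (intro sum.reindex_bij_betw) (simp add: skew_size_def skew_def)
  also have "\<dots> = (up_op ^^ n) (\<lambda>_. 1) (cells a)"
    by (rule sum_above_eq[OF young_cells[OF assms]])
  finally show ?thesis .
qed

lemma W_neg_eq:
  assumes "is_partition a"
  shows "W_neg a n = (down_op ^^ n) (\<lambda>_. 1) (cells a)"
proof -
  have "W_neg a n = (\<Sum>m | is_partition m \<and> skew_size a m (2 * n).
      down_mon n (cells a - cells m) * f2 n (cells a - cells m))"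
    by (simp add: W_neg_def down_mon_def skew_def)
  also have "\<dots> = (\<Sum>B\<in>young_below n (cells a). down_mon n (cells a - B) * f2 n (cells a - B))"
    using bij_betw_cells[of "\<lambda>B. B \<subseteq> cells a \<and> card (cells a - B) = 2 * n"]
    by (intro sum.reindex_bij_betw) (simp add: skew_size_def skew_def)
  also have "\<dots> = (down_op ^^ n) (\<lambda>_. 1) (cells a)"
    by (rule sum_below_eq[OF young_cells[OF assms]])
  finally show ?thesis .
qed

section \<open>Lengths of maximal sequences of domino removals\<close>

fun reduces :: "nat \<Rightarrow> cell set \<Rightarrow> bool" where
  "reduces 0 S \<longleftrightarrow> downs S = {}"
| "reduces (Suc k) S \<longleftrightarrow> (\<exists>B\<in>downs S. reduces k B)"

text \<open>By the diamond property all maximal sequences of domino removals have the same length.\<close>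

lemma reduces_down:
  assumes "young S" "reduces k S" "B \<in> downs S"
  shows "\<exists>k'. k = Suc k' \<and> reduces k' B"
  using assms
proof (induction k arbitrary: S B)
  case (Suc k)
  from Suc.prems(2) obtain B' where B': "B' \<in> downs S" "reduces k B'" by auto
  show ?case
  proof (cases "B' = B")
    case False
    \<comment> \<open>The meet is one removal below both \<open>B'\<close> and \<open>B\<close>, so
      the length known for \<open>B'\<close> passes through it to \<open>B\<close>.\<close>
    have C: "meet B' B \<in> downs B'" "meet B' B \<in> downs B"
      using diamond_down[OF Suc.prems(1) B'(1) Suc.prems(3) False] by auto
    obtain k' where "k = Suc k'" "reduces k' (meet B' B)"
      using Suc.IH[OF downs_young[OF B'(1)] B'(2) C(1)] by blast
    then show ?thesis using C(2) by auto
  qed (use B' in simp)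
qed simp

text \<open>Each application of \<open>down_op\<close> uses up one of the \<open>k\<close> available
  removals; after that the sum over \<open>downs\<close> is empty.\<close>

lemma down_op_funpow_reduces:
  assumes "young S" "reduces k S" "k < j"
  shows "(down_op ^^ j) f S = 0"
  using assms
proof (induction j arbitrary: S k)
  case (Suc j)
  have "(down_op ^^ j) f B = 0" if "B \<in> downs S" for B
  proof -
    from reduces_down[OF Suc.prems(1,2) that] obtain k' where "k = Suc k'" "reduces k' B" by blast
    then show ?thesis using Suc.IH[OF downs_young[OF that]] Suc.prems(3) by simp
  qed
  then show ?case unfolding funpow.simps o_apply down_op_def[of "(down_op ^^ j) f"] by simp
qed simp

lemma remove_domino_iff: "remove_domino l m \<longleftrightarrow> is_partition l \<and> is_partition m \<and>
    cells m \<in> downs (cells l)"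
  by (auto simp: remove_domino_def downs_def skew_def young_cells)

text \<open>Each removal deletes two cells, so the length of the sequence can be read off from the
  size of the difference; the size hypothesis of the theorem thus identifies it with the given
  \<open>k\<close>.\<close>

lemma two_core_reduces:
  assumes "is_partition a" "is_two_core c a"
  shows "\<exists>k. reduces k (cells a) \<and> cells c \<subseteq> cells a \<and> card (cells a - cells c) = 2 * k"
proof -
  have "remove_domino\<^sup>*\<^sup>* a c" and final: "\<not> remove_domino c m" for m
    using assms(2) by (auto simp: is_two_core_def)
  from this(1) assms(1) show ?thesis
  proof (induction rule: converse_rtranclp_induct)
    case base
    have "B \<notin> downs (cells c)" for B
    proof
      assume B: "B \<in> downs (cells c)"
      then obtain m where "is_partition m" "cells m = B" using young_is_cells downs_young by metis
      then show False using B final[of m] base by (simp add: remove_domino_iff)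
    qed
    then have "reduces 0 (cells c)" by auto
    then show ?case by force
  next
    case (step a b)
    then have b: "is_partition b" "cells b \<in> downs (cells a)" by (auto simp: remove_domino_iff)
    from step.IH[OF b(1)] obtain k where
      k: "reduces k (cells b)" "cells c \<subseteq> cells b" "card (cells b - cells c) = 2 * k" by blast
    have d: "cells b \<subseteq> cells a" "is_domino (cells a - cells b)" using b(2) by (auto simp: downs_def)
    have "card (cells a - cells c) = 2 * Suc k"
      using card_glue[OF finite_cells k(2) d] k(3) by simp
    moreover have "reduces (Suc k) (cells a)" using k(1) b(2) by auto
    ultimately show ?case using k(2) d(1) by blast
  qed
qed

theorem theorem3p11:
  fixes \<alpha> c :: "nat list" and k n :: nat
  assumes "is_partition \<alpha>"
    and "is_two_core c \<alpha>"
    and "skew_size \<alpha> c (2 * k)"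
  shows "W_pos \<alpha> n =
    (\<Sum>j = 0..k. of_nat (n choose j) * W_neg \<alpha> j * (\<Sum>\<pi> \<in> CI (n - j). wt (n - j) \<pi>))"
proof -
  let ?t = "\<lambda>j. of_nat (n choose j) * invol_poly (n - j) * (down_op ^^ j) (\<lambda>_. 1) (cells \<alpha>)"
  have young: "young (cells \<alpha>)" by (rule young_cells[OF assms(1)])
  have red: "reduces k (cells \<alpha>)"
    using two_core_reduces[OF assms(1,2)] assms(3) by (auto simp: skew_size_def skew_def)
  have "W_pos \<alpha> n = (\<Sum>j\<le>n. ?t j)"
    by (simp add: W_pos_eq[OF assms(1)] up_op_funpow_one[OF young])
  \<comment> \<open>The range is first enlarged, the binomials vanishing for \<open>j > n\<close>,
    and then cut back to \<open>k\<close>, beyond which the powers of \<open>down_op\<close> vanish.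
    Terms with \<open>n < j \<le> k\<close> are 0 in spite of the truncated
    \<open>n - j\<close>.\<close>
  also have "\<dots> = (\<Sum>j\<le>max n k. ?t j)"
    by (rule sum.mono_neutral_left) (auto simp: binomial_eq_0)
  also have "\<dots> = (\<Sum>j = 0..k. ?t j)"
    by (rule sum.mono_neutral_right) (auto simp: down_op_funpow_reduces[OF young red])
  also have "\<dots> = (\<Sum>j = 0..k. of_nat (n choose j) * W_neg \<alpha> j * (\<Sum>\<pi> \<in> CI (n - j). wt (n - j) \<pi>))"
    by (simp add: W_neg_eq[OF assms(1)] sum_CI mult_ac)
  finally show ?thesis .
qed

end
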